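(* Let $d\ge 2$. If $\ell$ is a non-degenerate leaf (chord of $\overline{\mathbb D}$), not a diameter, then there are $N(d)$ different full sibling collections which map onto $\ell$ under $\sigma_d$, distinct up to rotational symmetry, where $$N(d)=\frac1d\left(\frac1{d+1}\binom{2d}{d}+\sum_{n\mid d,\ n<d}\phi\left(\frac dn\right)\binom{2n}{n}\right)$$ and $\phi(x)$ is Euler's totient function, the number of positive integers less than, and relatively prime to, $x$.
   Context: $\mathbb S$ is the unit circle parameterized as $\mathbb R/\mathbb Z$, the boundary of the closed unit disk $\overline{\mathbb D}$; $\sigma_d:\mathbb S\to\mathbb S$ is $\sigma_d(t)=dt\pmod 1$. For a chord $\overline{ab}$ with endpoints $a,b\in\mathbb S$, $\sigma_d(\overline{ab})=\overline{\sigma_d(a)\sigma_d(b)}$; a chord is non-degenerate if its endpoints are distinct. A full sibling collection mapping onto $\ell$ is a set $\{\ell_1,\dots,\ell_d\}$ of $d$ chords of $\overline{\mathbb D}$ with $\sigma_d(\ell_i)=\ell$ for every $i$ and $\ell_i\cap\ell_j=\emptyset$ (also no common endpoints) for $i\neq j$. The count is over all such collections of chords, two collections being identified when one is the image of the other under a rotation of the disk. *)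

theory Defs
  imports "HOL-Analysis.Analysis" "HOL-Number_Theory.Totient"
begin

(* The circle R/Z, represented by the fundamental domain [0,1); circle_pt places the
   class of t on the boundary of the closed unit disk in the complex plane. *)
definition circle :: "real set"
  where "circle = {0..<1}"

definition circle_pt :: "real \<Rightarrow> complex"
  where "circle_pt t = cis (2 * pi * t)"

definition sigma :: "nat \<Rightarrow> real \<Rightarrow> real"
  where "sigma d t = frac (real d * t)"

(* Chords are straight and contain their endpoints; a = b gives a degenerate chord. *)
definition chord :: "real \<Rightarrow> real \<Rightarrow> complex set"
  where "chord a b = closed_segment (circle_pt a) (circle_pt b)"

definition chords :: "complex set set"
  where "chords = {chord a b | a b. a \<in> circle \<and> b \<in> circle}"

definition is_diameter :: "complex set \<Rightarrow> bool"
  where "is_diameter L \<longleftrightarrow> L \<in> chords \<and> 0 \<in> L"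

(* The chord joining the sigma-images of the endpoints of L. This is well defined, see
   lemma sigma_chord_chord; outside of chords the value is unspecified. *)
definition sigma_chord :: "nat \<Rightarrow> complex set \<Rightarrow> complex set"
  where "sigma_chord d L =
    (THE M. \<exists>a\<in>circle. \<exists>b\<in>circle. L = chord a b \<and> M = chord (sigma d a) (sigma d b))"

(* Since chords contain their endpoints, disjointness as point sets also excludes
   common endpoints. *)
definition full_sibling_collections :: "nat \<Rightarrow> complex set \<Rightarrow> complex set set set"
  where "full_sibling_collections d L =
    {C. C \<subseteq> chords \<and> finite C \<and> card C = d \<and> (\<forall>M\<in>C. sigma_chord d M = L)
        \<and> pairwise disjnt C}"

definition rotate_collection :: "real \<Rightarrow> complex set set \<Rightarrow> complex set set"
  where "rotate_collection \<theta> C = (\<lambda>M. (\<lambda>z. cis \<theta> * z) ` M) ` C"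

definition rotation_rel :: "nat \<Rightarrow> complex set \<Rightarrow> (complex set set \<times> complex set set) set"
  where "rotation_rel d L =
    {(C, C'). C \<in> full_sibling_collections d L \<and> C' \<in> full_sibling_collections d L
        \<and> (\<exists>\<theta>. C' = rotate_collection \<theta> C)}"

lemma circle_pt_inj: "inj_on circle_pt circle"
proof (rule inj_onI)
  fix a b assume ab: "a \<in> circle" "b \<in> circle" and eq: "circle_pt a = circle_pt b"
  from eq have "sin (2 * pi * a) = sin (2 * pi * b) \<and> cos (2 * pi * a) = cos (2 * pi * b)"
    by (simp add: circle_pt_def complex_eq_iff)
  then obtain n :: int where "2 * pi * a = 2 * pi * b + 2 * pi * n"
    using sin_cos_eq_iff[of "2 * pi * a" "2 * pi * b"] by auto
  then have "2 * pi * a = 2 * pi * (b + n)" by (simp add: algebra_simps)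
  then have n: "a = b + n" by simp
  with ab have "\<bar>real_of_int n\<bar> < 1" by (auto simp: circle_def)
  then have "n = 0" by linarith
  with n show "a = b" by simp
qed

lemma chord_eq_iff:
  assumes "a \<in> circle" "b \<in> circle" "a' \<in> circle" "b' \<in> circle"
  shows "chord a b = chord a' b' \<longleftrightarrow> {a, b} = {a', b'}"
proof -
  have "chord a b = chord a' b' \<longleftrightarrow> circle_pt ` {a, b} = circle_pt ` {a', b'}"
    by (simp add: chord_def)
  also have "\<dots> \<longleftrightarrow> {a, b} = {a', b'}"
    using assms by (intro inj_on_image_eq_iff[OF circle_pt_inj]) auto
  finally show ?thesis .
qed

lemma chord_commute: "chord a b = chord b a"
  by (simp add: chord_def closed_segment_commute)

lemma sigma_chord_chord:
  assumes "a \<in> circle" "b \<in> circle"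
  shows "sigma_chord d (chord a b) = chord (sigma d a) (sigma d b)"
  unfolding sigma_chord_def
proof (rule the_equality)
  show "\<exists>a'\<in>circle. \<exists>b'\<in>circle. chord a b = chord a' b' \<and>
      chord (sigma d a) (sigma d b) = chord (sigma d a') (sigma d b')"
    using assms by blast
next
  fix M assume "\<exists>a'\<in>circle. \<exists>b'\<in>circle. chord a b = chord a' b' \<and>
      M = chord (sigma d a') (sigma d b')"
  then show "M = chord (sigma d a) (sigma d b)"
    using assms by (auto simp: chord_eq_iff doubleton_eq_iff chord_commute)
qed

lemma rotate_collection_add:
  "rotate_collection \<theta> (rotate_collection \<theta>' C) = rotate_collection (\<theta> + \<theta>') C"
  by (simp add: rotate_collection_def image_image cis_mult[symmetric] mult.assoc)

lemma rotate_collection_0: "rotate_collection 0 C = C"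
  by (simp add: rotate_collection_def)

lemma equiv_rotation_rel: "equiv (full_sibling_collections d L) (rotation_rel d L)"
proof (rule equivI)
  show "rotation_rel d L \<subseteq> full_sibling_collections d L \<times> full_sibling_collections d L"
    by (auto simp: rotation_rel_def)
  show "refl_on (full_sibling_collections d L) (rotation_rel d L)"
  proof (rule refl_onI)
    fix C assume C: "C \<in> full_sibling_collections d L"
    have "\<exists>\<theta>. C = rotate_collection \<theta> C"
      by (rule exI[of _ 0]) (simp only: rotate_collection_0)
    with C show "(C, C) \<in> rotation_rel d L" unfolding rotation_rel_def by blast
  qed
  show "sym (rotation_rel d L)"
  proof (rule symI)
    fix C C' assume "(C, C') \<in> rotation_rel d L"
    then obtain \<theta> where mem: "C \<in> full_sibling_collections d L" "C' \<in> full_sibling_collections d L"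
      and \<theta>: "C' = rotate_collection \<theta> C" unfolding rotation_rel_def by blast
    have "C = rotate_collection (- \<theta>) C'"
      unfolding \<theta> by (simp add: rotate_collection_add rotate_collection_0)
    with mem show "(C', C) \<in> rotation_rel d L" unfolding rotation_rel_def by blast
  qed
  show "trans (rotation_rel d L)"
  proof (rule transI)
    fix C C' C'' assume "(C, C') \<in> rotation_rel d L" "(C', C'') \<in> rotation_rel d L"
    then obtain \<theta> \<theta>' where mem: "C \<in> full_sibling_collections d L" "C'' \<in> full_sibling_collections d L"
      and \<theta>: "C' = rotate_collection \<theta> C" "C'' = rotate_collection \<theta>' C'"
      unfolding rotation_rel_def by blast
    have "C'' = rotate_collection (\<theta>' + \<theta>) C"
      unfolding \<theta> by (rule rotate_collection_add)
    with mem show "(C, C'') \<in> rotation_rel d L" unfolding rotation_rel_def by blast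
  qed
qed

end

theory Submission
  imports Defs
begin

text \<open>The endpoints of a full sibling collection are the \<open>2 d\<close> preimages of the endpoints of the leaf,
  alternating around the circle, so a collection is a noncrossing perfect matching of \<open>2 d\<close> cyclically
  ordered points (noncrossing forces every chord to join points of opposite parity). Since the leaf is
  not a diameter, the rotations relating two collections are exactly the multiples of \<open>1 / d\<close>,
  and Burnside's lemma reduces the count to that of the matchings fixed by the rotation by \<open>n / d\<close>
  with \<open>n\<close> dividing \<open>d\<close>. For \<open>n = d\<close> these are counted by the Catalan number via ballot sequences.
  For \<open>n < d\<close> no chord passes through the centre, so each chord has a well-defined first endpoint
  in counterclockwise order on the side facing away from the centre; unrolled to the line, the matching
  becomes a noncrossing matching of the integers with period \<open>2 n\<close>. Such a matching is
  determined by its set of left endpoints, which can be any \<open>n\<close> of the \<open>2 n\<close> residues.\<close>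

section \<open>Orbit counting and ballot sequences\<close>

text \<open>The obstacle is that a matching on the circle has many lifts to the line: an arc of the
  line can run along either side of a chord. A count needs a canonical lift. Cutting the circle at
  one point gives one, but the cut is not respected by rotations; taking the side away from the
  centre commutes with rotations, but is undefined for a diameter, and a collection without symmetry
  may well contain one. Hence the identity and the proper rotations are counted with different
  lifts, which is why the formula has one exceptional term. Both lifts land in the same set
  \<open>periodic_matchings\<close>. A cut imposes the ballot condition (no arc may jump over it)
  and leaves a Catalan number; without a cut every balanced choice of left endpoints is admissible,
  which gives the full central binomial coefficient. The totients enter only through grouping the
  \<open>d\<close> rotations by \<open>gcd k d\<close>.\<close>

lemma card_orbits_cyclic:
  fixes r :: "'a \<Rightarrow> 'a"
  assumes fin: "finite X" and maps: "\<And>x. x \<in> X \<Longrightarrow> r x \<in> X"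
    and per: "\<And>x. x \<in> X \<Longrightarrow> (r ^^ d) x = x" and d: "d > 0"
  defines "R \<equiv> {(x, y). x \<in> X \<and> y \<in> X \<and> (\<exists>k. y = (r ^^ k) x)}"
  shows "d * card (X // R) = (\<Sum>k=1..d. card {x \<in> X. (r ^^ k) x = x})"
proof -
  have maps': "(r ^^ k) x \<in> X" if "x \<in> X" for k x
    using that by (induction k) (auto intro: maps)
  have mult: "(r ^^ (d * m)) x = x" if "x \<in> X" for m x
    using that per by (induction m) (auto simp: funpow_add)
  have modd: "(r ^^ k) x = (r ^^ (k mod d)) x" if "x \<in> X" for k x
  proof -
    have "(r ^^ k) x = (r ^^ (k mod d + d * (k div d))) x" by simp
    also have "\<dots> = (r ^^ (k mod d)) x" using mult[OF that] by (simp only: funpow_add o_def)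
    finally show ?thesis .
  qed
  have equiv: "equiv X R"
  proof (rule equivI)
    show "R \<subseteq> X \<times> X" by (auto simp: R_def)
    show "refl_on X R" unfolding refl_on_def R_def by (auto intro: exI[of _ 0])
    show "sym R"
    proof (rule symI)
      fix x y assume "(x, y) \<in> R"
      then obtain k where k: "x \<in> X" "y \<in> X" "y = (r ^^ k) x" by (auto simp: R_def)
      \<comment> \<open>No inverse of \<open>r\<close> is given; since \<open>r ^^ (d * k)\<close>
        is the identity on \<open>X\<close>, the power \<open>d * k - k\<close> undoes the power
        \<open>k\<close>.\<close>
      have "x = (r ^^ (d * k)) x" using mult k by simp
      also have "d * k = (d * k - k) + k" using d by (cases d) auto
      also have "(r ^^ \<dots>) x = (r ^^ (d * k - k)) y" by (simp only: k funpow_add o_def)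
      finally show "(y, x) \<in> R" using k by (auto simp: R_def)
    qed
    show "trans R"
    proof (rule transI)
      fix x y z assume "(x, y) \<in> R" "(y, z) \<in> R"
      then obtain k l where k: "x \<in> X" "z \<in> X" "z = (r ^^ l) ((r ^^ k) x)" by (auto simp: R_def)
      then have "z = (r ^^ (l + k)) x" by (simp add: funpow_add)
      with k show "(x, z) \<in> R" unfolding R_def by blast
    qed
  qed
  \<comment> \<open>The exponents below \<open>d\<close> that carry \<open>x\<close> to
    \<open>y\<close>. For \<open>x\<close>, \<open>y\<close> in one orbit, \<open>T y y\<close> and
    \<open>T x y\<close> have the same size (\<open>T_le\<close> in both directions), and the sets
    \<open>T x y\<close> partition all exponents as \<open>y\<close> runs through the orbit. So
    every orbit contributes exactly \<open>d\<close> to the sum of the stabiliser sizes.\<close>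
  define T where "T x y = {k \<in> {..<d}. (r ^^ k) x = y}" for x y
  have finT: "finite (T x y)" for x y by (simp add: T_def)
  have T_le: "card (T y z) \<le> card (T x z)" if "(x, y) \<in> R" for x y z
  proof -
    from that obtain k where k: "x \<in> X" "(r ^^ k) x = y" by (auto simp: R_def)
    have "inj_on (\<lambda>j. (j + k) mod d) (T y z)"
    proof (rule inj_onI)
      fix i j assume "i \<in> T y z" "j \<in> T y z" "(i + k) mod d = (j + k) mod d"
      then have "i < d" "j < d" "[i + k = j + k] (mod d)" by (auto simp: T_def cong_def)
      then show "i = j" by (metis cong_add_rcancel_nat cong_less_modulus_unique_nat)
    qed
    moreover have "(\<lambda>j. (j + k) mod d) ` T y z \<subseteq> T x z"
    proof safe
      fix j assume j: "j \<in> T y z"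
      have "(r ^^ ((j + k) mod d)) x = (r ^^ (j + k)) x"
        by (rule modd[OF k(1), symmetric])
      also have "\<dots> = z" using j k by (simp add: T_def funpow_add)
      finally show "(j + k) mod d \<in> T x z" using d by (simp add: T_def)
    qed
    ultimately show ?thesis by (rule card_inj_on_le) (rule finT)
  qed
  have class_sum: "(\<Sum>y\<in>c. card (T y y)) = d" if "c \<in> X // R" for c
  proof -
    from that obtain x where x: "x \<in> X" "c = R `` {x}" by (auto elim: quotientE)
    have c: "c = (\<lambda>k. (r ^^ k) x) ` {..<d}"
    proof safe
      fix y assume "y \<in> c"
      then obtain k where "y = (r ^^ k) x" by (auto simp: x R_def)
      then have "y = (r ^^ (k mod d)) x" using modd x by metis
      then show "y \<in> (\<lambda>k. (r ^^ k) x) ` {..<d}" using d by auto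
    qed (use x maps' in \<open>auto simp: R_def\<close>)
    have "(\<Sum>y\<in>c. card (T y y)) = (\<Sum>y\<in>c. card (T x y))"
    proof (rule sum.cong)
      fix y assume "y \<in> c"
      then have "(x, y) \<in> R" by (simp add: x)
      moreover from this equiv have "(y, x) \<in> R" by (auto elim: equivE dest: symD)
      ultimately show "card (T y y) = card (T x y)" using T_le by (metis le_antisym)
    qed simp
    also have "\<dots> = card (\<Union>y\<in>c. T x y)"
      by (intro card_UN_disjoint[symmetric]) (auto simp: T_def c)
    also have "(\<Union>y\<in>c. T x y) = {..<d}" by (auto simp: T_def c)
    finally show ?thesis by simp
  qed
  have "d * card (X // R) = (\<Sum>c\<in>X // R. \<Sum>y\<in>c. card (T y y))"
    by (simp add: class_sum)
  also have "\<dots> = (\<Sum>y\<in>\<Union>(X // R). card (T y y))"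
  proof -
    have "finite c" if "c \<in> X // R" for c
      using fin that equiv by (meson equivE finite_equiv_class)
    moreover have "c \<inter> c' = {}" if "c \<in> X // R" "c' \<in> X // R" "c \<noteq> c'" for c c'
      using quotient_disj[OF equiv] that by blast
    ultimately show ?thesis by (subst sum.Union_disjoint) auto
  qed
  also have "\<Union>(X // R) = X" by (rule Union_quotient[OF equiv])
  also have "(\<Sum>y\<in>X. card (T y y)) = (\<Sum>y\<in>X. \<Sum>k<d. if (r ^^ k) y = y then 1 else 0)"
    by (intro sum.cong) (auto simp: T_def sum.If_cases Int_def)
  also have "\<dots> = (\<Sum>k<d. \<Sum>y\<in>X. if (r ^^ k) y = y then 1 else 0)" by (rule sum.swap)
  also have "\<dots> = (\<Sum>k<d. card {y \<in> X. (r ^^ k) y = y})"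
    using fin by (intro sum.cong) (auto simp: sum.If_cases Int_def)
  \<comment> \<open>Exponent \<open>0\<close> is traded for \<open>d\<close>, both acting as the
    identity, so that the indices fit the range \<open>1..d\<close> on which \<open>gcd k d\<close>
    is grouped later.\<close>
  also have "\<dots> = (\<Sum>k=1..d. card {x \<in> X. (r ^^ k) x = x})"
  proof -
    obtain m where m: "d = Suc m" using d by (cases d) auto
    have *: "{y \<in> X. (r ^^ d) y = y} = {y \<in> X. (r ^^ 0) y = y}" using per by auto
    let ?g = "\<lambda>k. card {y \<in> X. (r ^^ k) y = y}"
    have "(\<Sum>k<d. ?g k) = ?g 0 + (\<Sum>k=1..m. ?g k)"
      unfolding m by (simp only: lessThan_Suc_atMost sum.atMost_shift)
         (simp add: sum.atLeast1_atMost_eq)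
    also have "?g 0 = ?g d" by (simp only: *)
    finally show ?thesis unfolding m by (simp only: sum.cl_ivl_Suc) simp
  qed
  finally show ?thesis .
qed

text \<open>The \<open>k\<close> in \<open>1..d\<close> with \<open>gcd k d = n\<close> are
  \<open>n\<close> times the numbers up to \<open>d div n\<close> that are coprime to
  \<open>d div n\<close>.\<close>

lemma sum_gcd_totient:
  fixes f :: "nat \<Rightarrow> nat"
  assumes "d > 0"
  shows "(\<Sum>k=1..d. f (gcd k d)) = (\<Sum>n | n dvd d. totient (d div n) * f n)"
proof -
  have fin: "finite {n. n dvd d}" using assms by simp
  have "(\<Sum>k=1..d. f (gcd k d)) = (\<Sum>n | n dvd d. \<Sum>k | k \<in> {1..d} \<and> gcd k d = n. f (gcd k d))"
    by (rule sum.group[symmetric]) (use fin in auto)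
  also have "\<dots> = (\<Sum>n | n dvd d. totient (d div n) * f n)"
  proof (rule sum.cong)
    fix n assume "n \<in> {n. n dvd d}"
    then have "card {k \<in> {0<..d}. gcd k d = n} = totient (d div n)"
      using assms by (intro card_gcd_eq_totient) auto
    moreover have "{0<..d} = {1..d}" by auto
    ultimately show "(\<Sum>k | k \<in> {1..d} \<and> gcd k d = n. f (gcd k d)) = totient (d div n) * f n"
      by simp
  qed simp
  finally show ?thesis .
qed

text \<open>Lattice paths with \<open>p\<close> up-steps and \<open>q\<close> down-steps that never
  go below their start, encoded by the positions of the up-steps: after \<open>k\<close> steps the
  height is \<open>2 * card (W \<inter> {0..<int k}) - k\<close>. Positions are integers because
  \<open>W\<close> will be the set of left endpoints of a matching of the integers.\<close>

definition ballot_sets :: "nat \<Rightarrow> nat \<Rightarrow> int set set" where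
  "ballot_sets p q = {W. W \<subseteq> {0..<int (p + q)} \<and> card W = p \<and>
     (\<forall>k\<le>p + q. k \<le> 2 * card (W \<inter> {0..<int k}))}"

lemma finite_ballot_sets: "finite (ballot_sets p q)"
  by (rule finite_subset[of _ "Pow {0..<int (p + q)}"]) (auto simp: ballot_sets_def)

lemma ballot_sets_empty: "p < q \<Longrightarrow> ballot_sets p q = {}"
proof -
  assume "p < q"
  have False if "W \<in> ballot_sets p q" for W
  proof -
    from that have W: "W \<subseteq> {0..<int (p + q)}" "card W = p"
      and "p + q \<le> 2 * card (W \<inter> {0..<int (p + q)})" by (auto simp: ballot_sets_def)
    with \<open>p < q\<close> show False by (simp add: Int_absorb2)
  qed
  then show ?thesis by blast
qed

lemma card_ballot_sets_0: "card (ballot_sets p 0) = 1"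
proof -
  have "W = {0..<int p}" if "W \<subseteq> {0..<int p}" "card W = p" for W
    using that by (intro card_subset_eq) auto
  moreover have "{0..<int p} \<inter> {0..<int k} = {0..<int k}" if "k \<le> p" for k using that by auto
  ultimately have "ballot_sets p 0 = {{0..<int p}}" by (auto simp: ballot_sets_def)
  then show ?thesis by simp
qed

text \<open>Split by whether the last step, at position \<open>p + q + 1\<close>, goes up or down.
  Appending a step adds only the prefix condition at full length, and \<open>q \<le> p\<close>
  guarantees that one.\<close>

lemma card_ballot_sets_Suc:
  assumes "q \<le> p"
  shows "card (ballot_sets (Suc p) (Suc q)) = card (ballot_sets p (Suc q)) + card (ballot_sets (Suc p) q)"
proof -
  let ?n = "Suc (p + q)"
  let ?l = "int ?n"
  have cut: "insert ?l W \<inter> {0..<int k} = W \<inter> {0..<int k}" if "k \<le> ?n" for k W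
    using that by auto
  have last: "{0..<int (Suc ?n)} = insert ?l {0..<?l}" by auto
  have "ballot_sets (Suc p) (Suc q) = insert ?l ` ballot_sets p (Suc q) \<union> ballot_sets (Suc p) q"
  proof (intro equalityI subsetI)
    fix W assume W: "W \<in> ballot_sets (Suc p) (Suc q)"
    then have sub: "W \<subseteq> {0..<int (Suc ?n)}" and card: "card W = Suc p"
      and pre: "\<And>k. k \<le> Suc ?n \<Longrightarrow> k \<le> 2 * card (W \<inter> {0..<int k})"
      by (auto simp: ballot_sets_def)
    show "W \<in> insert ?l ` ballot_sets p (Suc q) \<union> ballot_sets (Suc p) q"
    proof (cases "?l \<in> W")
      case True
      define V where "V = W - {?l}"
      have W_eq: "W = insert ?l V" and V: "?l \<notin> V" using True by (auto simp: V_def)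
      have "V \<subseteq> {0..<?l}" using sub last by (auto simp: V_def)
      moreover have "card V = p" using card True by (simp add: V_def)
      moreover have "k \<le> 2 * card (V \<inter> {0..<int k})" if "k \<le> ?n" for k
        using pre[of k] that cut[OF that, of V] by (simp add: W_eq)
      ultimately have "V \<in> ballot_sets p (Suc q)" by (simp add: ballot_sets_def)
      then show ?thesis using W_eq by blast
    next
      case False
      then have "W \<subseteq> {0..<?l}" using sub last by auto
      then have "W \<in> ballot_sets (Suc p) q" using card pre by (auto simp: ballot_sets_def)
      then show ?thesis by blast
    qed
  next
    fix W assume "W \<in> insert ?l ` ballot_sets p (Suc q) \<union> ballot_sets (Suc p) q"
    then show "W \<in> ballot_sets (Suc p) (Suc q)"
    proof
      assume "W \<in> insert ?l ` ballot_sets p (Suc q)"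
      then obtain V where W: "W = insert ?l V" and V: "V \<subseteq> {0..<?l}" "card V = p"
         and pre: "\<And>k. k \<le> ?n \<Longrightarrow> k \<le> 2 * card (V \<inter> {0..<int k})"
        by (auto simp: ballot_sets_def)
      have sub: "W \<subseteq> {0..<int (Suc ?n)}" using V last by (auto simp: W)
      have "finite V" using V finite_subset by blast
      then have cd: "card W = Suc p" using V by (auto simp: W card_insert_if)
      have "k \<le> 2 * card (W \<inter> {0..<int k})" if "k \<le> Suc ?n" for k
      proof (cases "k \<le> ?n")
        case True
        then show ?thesis using pre cut[OF True, of V] by (simp only: W)
      next
        case False
        then have "k = Suc ?n" using that by simp
        then have "W \<inter> {0..<int k} = W" using sub by auto
        then show ?thesis using \<open>k = Suc ?n\<close> cd assms by simp
      qed
      then show ?thesis using sub cd by (simp add: ballot_sets_def)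
    next
      assume "W \<in> ballot_sets (Suc p) q"
      then have W: "W \<subseteq> {0..<?l}" "card W = Suc p"
         and pre: "\<And>k. k \<le> ?n \<Longrightarrow> k \<le> 2 * card (W \<inter> {0..<int k})"
        by (auto simp: ballot_sets_def)
      have sub: "W \<subseteq> {0..<int (Suc ?n)}" using W last by auto
      have "k \<le> 2 * card (W \<inter> {0..<int k})" if "k \<le> Suc ?n" for k
      proof (cases "k \<le> ?n")
        case False
        then have "k = Suc ?n" using that by simp
        then have "W \<inter> {0..<int k} = W" using sub by auto
        then show ?thesis using \<open>k = Suc ?n\<close> W assms by simp
      qed (rule pre)
      then show ?thesis using sub W by (simp add: ballot_sets_def)
    qed
  qed
  moreover have "?l \<notin> W" if "W \<in> ballot_sets p (Suc q) \<union> ballot_sets (Suc p) q" for W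
    using that by (auto simp: ballot_sets_def)
  then have "insert ?l ` ballot_sets p (Suc q) \<inter> ballot_sets (Suc p) q = {}"
    and "inj_on (insert ?l) (ballot_sets p (Suc q))"
    by (auto intro!: inj_onI dest: insert_ident)
  ultimately show ?thesis
    by (simp add: card_Un_disjoint finite_ballot_sets card_image)
qed

text \<open>The classical ballot number, a difference of two binomials, written additively to avoid
  truncated subtraction. The induction is Pascal's rule. The range includes
  \<open>q = Suc p\<close>, where there is no ballot path and the two binomials coincide, because
  lowering \<open>p\<close> in the recursion can reach that boundary.\<close>

lemma card_ballot_sets:
  "q \<le> Suc p \<Longrightarrow> card (ballot_sets p q) + ((p + q) choose Suc p) = (p + q) choose p"
proof (induction "p + q" arbitrary: p q rule: less_induct)
  case less
  show ?case
  proof (cases q)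
    case 0
    then show ?thesis by (simp add: card_ballot_sets_0)
  next
    case q: (Suc q')
    show ?thesis
    proof (cases "q' = p")
      case True
      then have "(p + q) choose Suc p = (p + q) choose p"
        using binomial_symmetric[of p "p + q"] by (simp add: q)
      then show ?thesis using ballot_sets_empty[of p q] True by (simp add: q)
    next
      case False
      then obtain p' where p: "p = Suc p'" and le: "q' \<le> p'" using less.prems q by (cases p) auto
      have 1: "card (ballot_sets p' q) + ((p' + q) choose Suc p') = (p' + q) choose p'"
        by (rule less.hyps) (use le in \<open>auto simp: p q\<close>)
      have 2: "card (ballot_sets p q') + ((p + q') choose Suc p) = (p + q') choose p"
        by (rule less.hyps) (use le in \<open>auto simp: p q\<close>)
      show ?thesis using 1 2 card_ballot_sets_Suc[OF le] by (simp add: p q)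
    qed
  qed
qed

lemma card_ballot_sets_diag:
  "real (card (ballot_sets d d)) = 1 / real (d + 1) * real ((2 * d) choose d)"
proof -
  have "card (ballot_sets d d) + ((2 * d) choose Suc d) = (2 * d) choose d"
    using card_ballot_sets[of d d] by (simp add: mult_2)
  moreover have "Suc d * ((2 * d) choose Suc d) = d * ((2 * d) choose d)"
  proof -
    have "2 * d - d = d" by simp
    then show ?thesis using binomial_absorb_comp[of "2 * d" d] by (metis binomial_absorption)
  qed
  ultimately have "Suc d * card (ballot_sets d d) + d * ((2 * d) choose d) = Suc d * ((2 * d) choose d)"
    by (metis add_mult_distrib2)
  then have "Suc d * card (ballot_sets d d) = (2 * d) choose d" by simp
  then have "real (d + 1) * real (card (ballot_sets d d)) = real ((2 * d) choose d)"
    by (metis Suc_eq_plus1 of_nat_mult)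
  then show ?thesis by (simp add: field_simps)
qed

section \<open>Periodic noncrossing matchings of the integers\<close>

lemma card_involution_double:
  assumes "finite S" "\<And>x. x \<in> S \<Longrightarrow> g x \<in> S" "\<And>x. x \<in> S \<Longrightarrow> g (g x) = x"
    "\<And>x. x \<in> S \<Longrightarrow> P (g x) \<longleftrightarrow> \<not> P x"
  shows "card S = 2 * card {x \<in> S. P x}"
proof -
  have "bij_betw g {x \<in> S. P x} {x \<in> S. \<not> P x}"
    by (rule bij_betw_byWitness[of _ g]) (use assms in auto)
  then have "card {x \<in> S. P x} = card {x \<in> S. \<not> P x}" by (rule bij_betw_same_card)
  moreover have "card S = card {x \<in> S. P x} + card {x \<in> S. \<not> P x}"
    using assms(1) by (subst card_Un_disjoint[symmetric]) (auto intro: arg_cong[of _ _ card])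
  ultimately show ?thesis by simp
qed

text \<open>Noncrossing is tested from the left end of an arc only; for a right end \<open>x\<close>
  the premise is vacuous.\<close>

definition periodic_matchings :: "int \<Rightarrow> (int \<Rightarrow> int) set" where
  "periodic_matchings N = {f. (\<forall>x. f (f x) = x \<and> f x \<noteq> x \<and> f (x + N) = f x + N) \<and>
     (\<forall>x y. x < y \<and> y < f x \<longrightarrow> x < f y \<and> f y < f x)}"

lemma periodic_matchingsD:
  assumes "f \<in> periodic_matchings N"
  shows "f (f x) = x" "f x \<noteq> x" "f (x + N) = f x + N"
    "x < y \<Longrightarrow> y < f x \<Longrightarrow> x < f y" "x < y \<Longrightarrow> y < f x \<Longrightarrow> f y < f x"
  using assms by (auto simp: periodic_matchings_def)

lemma periodic_matchings_add_mult:
  assumes f: "f \<in> periodic_matchings N"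
  shows "f (x + N * k) = f x + N * k"
proof -
  have nat: "f (x + N * int m) = f x + N * int m" for m x
  proof (induction m)
    case (Suc m)
    then show ?case using periodic_matchingsD(3)[OF f, of "x + N * int m"]
      by (simp add: algebra_simps)
  qed simp
  show ?thesis
  proof (cases "k \<ge> 0")
    case True
    then show ?thesis using nat[of x "nat k"] by simp
  next
    case False
    then show ?thesis using nat[of "x + N * k" "nat (- k)"] by simp
  qed
qed

lemma periodic_matchings_dvd:
  "f \<in> periodic_matchings N \<Longrightarrow> N dvd M \<Longrightarrow> f \<in> periodic_matchings M"
  using periodic_matchings_add_mult[of f N] by (fastforce simp: periodic_matchings_def elim!: dvdE)

text \<open>An arc longer than \<open>N\<close> would have the left end \<open>x + N\<close> of its
  own translate under it, but not the right end \<open>f x + N\<close>. Length exactly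
  \<open>N\<close> would match \<open>x + N\<close> both with \<open>x\<close> and with
  \<open>x + 2 * N\<close>.\<close>

lemma periodic_matchings_dist:
  assumes f: "f \<in> periodic_matchings N" and N: "N > 0"
  shows "\<bar>f x - x\<bar> < N"
proof -
  have *: "f x < x + N" if "x < f x" for x
  proof (rule ccontr)
    assume "\<not> f x < x + N"
    then consider "x + N < f x" | "f x = x + N" by linarith
    then show False
    proof cases
      case 1
      have "f (x + N) < f x" by (rule periodic_matchingsD(5)[OF f]) (use 1 N in auto)
      then show False using periodic_matchingsD(3)[OF f, of x] N by simp
    next
      case 2
      then have "f (x + N) = x" using periodic_matchingsD(1)[OF f, of x] by simp
      then show False using periodic_matchingsD(3)[OF f, of x] 2 N by simp
    qed
  qed
  show ?thesis
    using *[of x] *[of "f x"] periodic_matchingsD(1,2)[OF f, of x] by linarith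
qed

lemma periodic_matchings_less_iff:
  assumes f: "f \<in> periodic_matchings N"
  shows "f x < f (f x) \<longleftrightarrow> \<not> x < f x"
  using periodic_matchingsD(1,2)[OF f, of x] by auto

text \<open>The points strictly under an arc are matched among themselves, so their number is even.
  This is where noncrossing yields opposite parity of partners.\<close>

lemma periodic_matchings_odd:
  assumes f: "f \<in> periodic_matchings N"
  shows "odd (f x - x)"
proof -
  have *: "odd (f x - x)" if "x < f x" for x
  proof -
    have "card {x<..<f x} = 2 * card {y \<in> {x<..<f x}. y < f y}"
      using periodic_matchingsD[OF f] periodic_matchings_less_iff[OF f]
      by (intro card_involution_double[where g = f]) auto
    moreover have "int (card {x<..<f x}) = f x - x - 1" using that by simp
    ultimately have "even (f x - x - 1)" by (metis dvd_triv_left even_of_nat)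
    then show ?thesis by simp
  qed
  show ?thesis
  proof (cases "x < f x")
    case False
    then have "f x < f (f x)" using periodic_matchings_less_iff[OF f] by blast
    then have "odd (f (f x) - f x)" by (rule *)
    then show ?thesis by (simp add: periodic_matchingsD(1)[OF f])
  qed (rule *)
qed

text \<open>Induction on the length of an \<open>f\<close>-arc: under the arc from \<open>x\<close>
  to \<open>f x\<close> the two matchings already agree, so \<open>g x\<close> cannot fall short of
  \<open>f x\<close>.\<close>

lemma periodic_matchings_eqI:
  assumes f: "f \<in> periodic_matchings N" and g: "g \<in> periodic_matchings N"
    and eq: "\<And>x. x < f x \<longleftrightarrow> x < g x"
  shows "f = g"
proof -
  have up: "f x = g x" if "x < f x" for x
    using that
  proof (induction "nat (f x - x)" arbitrary: x rule: less_induct)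
    case less
    have inner: "g y = f y" if y: "x < y" "y < f x" for y
    proof -
      from y have fy: "x < f y" "f y < f x" using periodic_matchingsD(4,5)[OF f] by blast+
      show ?thesis
      proof (cases "y < f y")
        case True
        then show ?thesis using less.hyps[of y] y fy by auto
      next
        case False
        then have "f y < f (f y)" using periodic_matchings_less_iff[OF f] by blast
        then have "f (f y) = g (f y)" using less.hyps[of "f y"] y fy
          by (auto simp: periodic_matchingsD(1)[OF f])
        then show ?thesis by (metis periodic_matchingsD(1)[OF f] periodic_matchingsD(1)[OF g])
      qed
    qed
    have gx: "x < g x" using eq less.prems by blast
    have closer: "\<not> f x < g (f x)"
      using eq[of "f x"] less.prems by (simp add: periodic_matchingsD(1)[OF f])
    have "\<not> g x < f x"
    proof
      assume *: "g x < f x"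
      then have "f (g x) = x" using inner[of "g x"] gx by (simp add: periodic_matchingsD(1)[OF g])
      then show False using * by (metis less_irrefl periodic_matchingsD(1)[OF f])
    qed
    \<comment> \<open>The point \<open>f x\<close> is a right end for \<open>g\<close> too. Under a
      longer \<open>g\<close>-arc from \<open>x\<close>, its \<open>g\<close>-partner would lie
      strictly between \<open>x\<close> and \<open>f x\<close>, where \<open>f\<close> and
      \<open>g\<close> agree; but \<open>f\<close> matches \<open>f x\<close> with
      \<open>x\<close>.\<close>
    moreover have "\<not> f x < g x"
    proof
      assume *: "f x < g x"
      then have "x < g (f x)" using periodic_matchingsD(4)[OF g, of x "f x"] less.prems by simp
      moreover have "g (f x) < f x" using closer periodic_matchingsD(2)[OF g, of "f x"] by linarith
      ultimately have "f (g (f x)) = f x" using inner[of "g (f x)"] periodic_matchingsD(1)[OF g, of "f x"] by simp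
      then have "g (f x) = x" by (metis periodic_matchingsD(1)[OF f])
      then show False using \<open>x < g (f x)\<close> by simp
    qed
    ultimately show ?case by simp
  qed
  show ?thesis
  proof
    fix x
    show "f x = g x"
    proof (cases "x < f x")
      case False
      then have "f x < f (f x)" using periodic_matchings_less_iff[OF f] by blast
      then have "f (f x) = g (f x)" by (rule up)
      then show ?thesis by (metis periodic_matchingsD(1)[OF f] periodic_matchingsD(1)[OF g])
    qed (rule up)
  qed
qed

text \<open>Parenthesis matching on an infinite path: an up-step at \<open>i\<close> is paired with
  the down-step at the first \<open>j\<close> after which the path is back at level
  \<open>h i\<close>; this is \<open>rel i j\<close>.\<close>

lemma periodic_matching_of_heights:
  fixes h :: "int \<Rightarrow> int"
  assumes N: "N > 0" and step: "\<And>x. h (x + 1) = h x + 1 \<or> h (x + 1) = h x - 1"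
    and per: "\<And>x. h (x + N) = h x"
  shows "\<exists>f\<in>periodic_matchings N. \<forall>x. x < f x \<longleftrightarrow> h (x + 1) = h x + 1"
proof -
  define rel where "rel i j \<longleftrightarrow> i < j \<and> h (j + 1) = h i \<and> (\<forall>k. i < k \<and> k \<le> j \<longrightarrow> h i < h k)" for i j
  have relD: "i < j" "h (j + 1) = h i" "\<And>k. i < k \<Longrightarrow> k \<le> j \<Longrightarrow> h i < h k" if "rel i j" for i j
    using that by (auto simp: rel_def)
  have rel_up: "h (i + 1) = h i + 1" if "rel i j" for i j
    using relD(3)[OF that, of "i + 1"] relD(1)[OF that] step[of i] by auto
  have rel_down: "h (j + 1) = h j - 1" if "rel i j" for i j
    using relD(3)[OF that, of j] relD(1,2)[OF that] step[of j] by auto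
  have ex_right: "\<exists>j. rel i j" if up: "h (i + 1) = h i + 1" for i
  proof -
    let ?P = "\<lambda>m::nat. h (i + 1 + int m) \<le> h i"
    define m where "m = (LEAST m. ?P m)"
    \<comment> \<open>Periodicity bounds the search: after a full period the path is again at level
      \<open>h i\<close>.\<close>
    have "?P (nat (N - 1))" using per[of i] N by simp
    then have Pm: "?P m" unfolding m_def by (rule LeastI)
    have less: "h i < h (i + 1 + int l)" if "l < m" for l
      using not_less_Least[of l ?P] that unfolding m_def by simp
    have "m \<noteq> 0" using Pm up by (intro notI) simp
    then obtain l where l: "m = Suc l" by (cases m) auto
    have below: "h i < h k" if "i < k" "k \<le> i + 1 + int l" for k
      using less[of "nat (k - i - 1)"] that l by auto
    have "h (i + 1 + int l + 1) \<le> h i" using Pm l by (simp add: algebra_simps)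
    with below[of "i + 1 + int l"] step[of "i + 1 + int l"] have "h (i + 1 + int l + 1) = h i" by auto
    then have "rel i (i + 1 + int l)"
      using below by (simp add: rel_def)
    then show ?thesis ..
  qed
  have ex_left: "\<exists>i. rel i j" if down: "h (j + 1) = h j - 1" for j
  proof -
    let ?P = "\<lambda>m::nat. h (j - int m) \<le> h (j + 1)"
    define m where "m = (LEAST m. ?P m)"
    have "?P (nat (N - 1))" using per[of "j + 1 - N"] N by (simp add: algebra_simps)
    then have Pm: "?P m" unfolding m_def by (rule LeastI)
    have less: "h (j + 1) < h (j - int l)" if "l < m" for l
      using not_less_Least[of l ?P] that unfolding m_def by simp
    have "m \<noteq> 0" using Pm down by (intro notI) simp
    then obtain l where l: "m = Suc l" by (cases m) auto
    have above: "h (j + 1) < h k" if "j - int m < k" "k \<le> j" for k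
      using less[of "nat (j - k)"] that l by auto
    have "h (j - int m + 1) = h (j - int m) + 1" "h (j - int m) = h (j + 1)"
      using Pm above[of "j - int m + 1"] step[of "j - int m"] l by auto
    then have "rel (j - int m) j" using above l by (simp add: rel_def)
    then show ?thesis ..
  qed
  have right_unique: "j = j'" if "rel i j" "rel i j'" for i j j'
  proof -
    have "\<not> j < j'" if "rel i j" "rel i j'" for j j'
      using relD(1,2)[OF that(1)] relD(3)[OF that(2), of "j + 1"] by auto
    with that show ?thesis by (meson linorder_cases)
  qed
  have left_unique: "i = i'" if "rel i j" "rel i' j" for i i' j
  proof -
    have "\<not> i < i'" if "rel i j" "rel i' j" for i i'
      using relD(1,2)[OF that(2)] relD(2)[OF that(1)] relD(3)[OF that(1), of i'] by auto
    with that show ?thesis by (meson linorder_cases)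
  qed
  have rel_shift: "rel (i + N) (j + N)" if "rel i j" for i j
  proof -
    have "h (i + N) < h k" if "i + N < k" "k \<le> j + N" for k
      using relD(3)[OF \<open>rel i j\<close>, of "k - N"] per[of "k - N"] per[of i] that by simp
    then show ?thesis using relD(1,2)[OF that] per[of i] per[of "j + 1"]
      by (simp add: rel_def algebra_simps)
  qed
  have ex1: "\<exists>!y. rel x y \<or> rel y x" for x
  proof (cases "h (x + 1) = h x + 1")
    case True
    moreover have "\<not> rel y x" for y using rel_down[of y x] True by auto
    ultimately show ?thesis using ex_right[of x] right_unique by blast
  next
    case False
    moreover have "\<not> rel x y" for y using rel_up[of x y] False by auto
    ultimately show ?thesis using ex_left[of x] left_unique step[of x] by blast
  qed
  define f where "f x = (THE y. rel x y \<or> rel y x)" for x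
  have f: "rel x (f x) \<or> rel (f x) x" for x unfolding f_def by (rule theI'[OF ex1])
  have f_eq: "f x = y" if "rel x y \<or> rel y x" for x y using ex1 that f by blast
  have f_rel: "rel x (f x)" if "x < f x" for x using f[of x] relD(1)[of "f x" x] that by auto
  have "f (f x) = x" "f x \<noteq> x" "f (x + N) = f x + N" for x
  proof -
    show "f (f x) = x" using f f_eq by blast
    show "f x \<noteq> x" using f[of x] relD(1)[of x x] by auto
    show "f (x + N) = f x + N" using f[of x] rel_shift f_eq by blast
  qed
  \<comment> \<open>Compare levels. If \<open>y\<close> opens an arc ending beyond
    \<open>f x\<close>, the path at \<open>f x + 1\<close> has level \<open>h x\<close>, yet must be
    above \<open>h y\<close>, which exceeds \<open>h x\<close>. If \<open>y\<close> closes an arc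
    begun before \<open>x\<close>, then \<open>h (y + 1) = h (f y)\<close> is below
    \<open>h x\<close>, although \<open>y + 1\<close> still lies under the arc of
    \<open>x\<close>.\<close>
  moreover have "x < f y \<and> f y < f x" if xy: "x < y" "y < f x" for x y
  proof -
    have x: "rel x (f x)" using f_rel xy by auto
    from f[of y] show ?thesis
    proof
      assume y: "rel y (f y)"
      have "h x < h y" using relD(3)[OF x] xy by simp
      moreover have "h y < h (f x + 1)" if "f x + 1 \<le> f y"
        using relD(3)[OF y, of "f x + 1"] xy that by simp
      ultimately have "\<not> f x + 1 \<le> f y" using relD(2)[OF x] by auto
      moreover have "f y \<noteq> f x" using left_unique[of x "f x" y] x y xy by auto
      ultimately show ?thesis using relD(1)[OF y] xy by auto
    next
      assume y: "rel (f y) y"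
      have *: "h x < h (y + 1)" using relD(3)[OF x, of "y + 1"] xy by simp
      have "f y \<noteq> x" using f_eq[of x y] y xy by auto
      moreover have "h (f y) < h x" if "f y < x" using relD(3)[OF y, of x] xy that by simp
      ultimately have "x < f y" using * relD(2)[OF y] by force
      then show ?thesis using relD(1)[OF y] xy by auto
    qed
  qed
  moreover have "x < f x \<longleftrightarrow> h (x + 1) = h x + 1" for x
    using f[of x] f_rel[of x] rel_up[of x "f x"] rel_down[of "f x" x] relD(1)[of "f x" x] relD(1)[of x "f x"] by auto
  ultimately show ?thesis unfolding periodic_matchings_def by (intro bexI[of _ f]) auto
qed

text \<open>Injectivity is recovery of a matching from its left ends; for surjectivity,
  \<open>V\<close> prescribes the up-steps of a height path, which closes up over a period because
  \<open>V\<close> contains exactly half of the residues.\<close>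

lemma periodic_matchings_trace:
  assumes n: "n > 0"
  defines "N \<equiv> 2 * int n"
  shows "bij_betw (\<lambda>f. {x \<in> {0..<N}. x < f x}) (periodic_matchings N) {V. V \<subseteq> {0..<N} \<and> card V = n}"
    (is "bij_betw ?t _ ?S")
proof (rule bij_betw_imageI)
  have N: "N > 0" using n by (simp add: N_def)
  have mod_eq: "N * (x div N) + x mod N = x" for x by simp
  have up_mod: "x < f x \<longleftrightarrow> x mod N < f (x mod N)" if f: "f \<in> periodic_matchings N" for f x
  proof -
    have "f x = f (x mod N) + N * (x div N)"
      using periodic_matchings_add_mult[OF f, of "x mod N" "x div N"] by simp
    then show ?thesis using mod_eq[of x] by linarith
  qed
  show "inj_on ?t (periodic_matchings N)"
  proof (rule inj_onI)
    fix f g assume fg: "f \<in> periodic_matchings N" "g \<in> periodic_matchings N" and eq: "?t f = ?t g"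
    show "f = g"
    proof (rule periodic_matchings_eqI[OF fg])
      fix x
      have "x mod N \<in> ?t f \<longleftrightarrow> x mod N \<in> ?t g" by (simp only: eq)
      then show "x < f x \<longleftrightarrow> x < g x" using N up_mod[OF fg(1), of x] up_mod[OF fg(2), of x] by simp
    qed
  qed
  have "?t f \<in> ?S" if f: "f \<in> periodic_matchings N" for f
  proof -
    \<comment> \<open>Modulo \<open>N\<close> the matching becomes an involution of the residues
      that exchanges left ends and right ends.\<close>
    have "card {0..<N} = 2 * card (?t f)"
    proof (rule card_involution_double[where g = "\<lambda>x. f x mod N"])
      fix x assume x: "x \<in> {0..<N}"
      have *: "f (f x mod N) = x + N * (- (f x div N))"
        using periodic_matchings_add_mult[OF f, of "f x" "- (f x div N)"] periodic_matchingsD(1)[OF f, of x]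
        by (simp add: minus_mult_div_eq_mod[symmetric])
      then have "f (f x mod N) mod N = x mod N" by (simp only: mod_mult_self2)
      then show "f (f x mod N) mod N = x" using x by simp
      show "f x mod N < f (f x mod N) \<longleftrightarrow> \<not> x < f x"
        using up_mod[OF f, of "f x"] periodic_matchings_less_iff[OF f, of x] by simp
    qed (use N in auto)
    then show ?thesis by (auto simp: N_def)
  qed
  moreover have "V \<in> ?t ` periodic_matchings N" if V: "V \<in> ?S" for V
  proof -
    define s where "s x = (if x mod N \<in> V then 1 else -1 :: int)" for x
    \<comment> \<open>Summing only up to \<open>x mod N\<close> makes \<open>h\<close> periodic by
      construction; the step across a multiple of \<open>N\<close> is then correct because
      \<open>total\<close> vanishes.\<close>
    define h where "h x = (\<Sum>k\<in>{0..<x mod N}. s k)" for x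
    have total: "(\<Sum>k\<in>{0..<N}. s k) = 0"
    proof -
      have "(\<Sum>k\<in>{0..<N}. s k) = (\<Sum>k\<in>{0..<N}. if k \<in> V then 1 else -1)"
        by (intro sum.cong) (auto simp: s_def)
      also have "\<dots> = int (card V) - int (card ({0..<N} - V))"
        using V by (subst sum.If_cases) (auto simp: Int_absorb1 Diff_eq)
      also have "card ({0..<N} - V) = n"
        using V finite_subset[of V "{0..<N}"] by (simp add: card_Diff_subset N_def)
      finally show ?thesis using V by simp
    qed
    have step: "h (x + 1) = h x + s x" for x
    proof -
      let ?m = "x mod N"
      have m: "0 \<le> ?m" "?m < N" using N by auto
      have "s ?m = s x" by (simp add: s_def)
      moreover have "{0..<?m + 1} = insert ?m {0..<?m}" using m by auto
      ultimately have *: "(\<Sum>k\<in>{0..<?m + 1}. s k) = h x + s x" by (simp add: h_def)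
      show ?thesis
      proof (cases "?m + 1 = N")
        case True
        then have "(x + 1) mod N = 0" by (metis mod_add_left_eq mod_self)
        then show ?thesis using * total True by (simp add: h_def)
      next
        case False
        then have "0 \<le> ?m + 1" "?m + 1 < N" using m by auto
        then have "(x + 1) mod N = ?m + 1" by (metis mod_add_left_eq mod_pos_pos_trivial)
        then show ?thesis using * by (simp add: h_def)
      qed
    qed
    have "\<exists>f\<in>periodic_matchings N. \<forall>x. x < f x \<longleftrightarrow> h (x + 1) = h x + 1"
      by (rule periodic_matching_of_heights[OF N]) (use step in \<open>auto simp: s_def h_def\<close>)
    then obtain f where f: "f \<in> periodic_matchings N" "\<And>x. x < f x \<longleftrightarrow> x mod N \<in> V"
      by (auto simp: step s_def split: if_splits)
    have "?t f = V" using f(2) V by auto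
    then show ?thesis using f(1) by blast
  qed
  ultimately show "?t ` periodic_matchings N = ?S" by blast
qed

lemma card_periodic_matchings:
  "n > 0 \<Longrightarrow> card (periodic_matchings (2 * int n)) = (2 * n) choose n"
  using bij_betw_same_card[OF periodic_matchings_trace] n_subsets[of "{0..<2 * int n}" n]
  by (simp add: nat_mult_distrib)

text \<open>No arc crosses a multiple of \<open>N\<close> exactly when the left ends in
  \<open>{0..<N}\<close> form a ballot set. If blocks are preserved, the right ends in a prefix
  inject into the left ends of that prefix.\<close>

lemma card_block_matchings:
  assumes n: "n > 0"
  defines "N \<equiv> 2 * int n"
  shows "card {f \<in> periodic_matchings N. \<forall>x\<in>{0..<N}. f x \<in> {0..<N}} = card (ballot_sets n n)"
proof -
  let ?t = "\<lambda>f. {x \<in> {0..<N}. x < f x}"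
  have N: "N > 0" using n by (simp add: N_def)
  have block_iff: "(\<forall>x\<in>{0..<N}. f x \<in> {0..<N}) \<longleftrightarrow> ?t f \<in> ballot_sets n n"
    if f: "f \<in> periodic_matchings N" for f
  proof
    from bij_betwE[OF periodic_matchings_trace[OF n]] f
    have card_t: "card (?t f) = n" by (auto simp: N_def)
    have split: "card {x\<in>A. x < f x} + card {x\<in>A. f x < x} = card A" if "finite A" for A
    proof -
      have "x < f x \<or> f x < x" for x using periodic_matchingsD(2)[OF f, of x] by linarith
      then have "A = {x\<in>A. x < f x} \<union> {x\<in>A. f x < x}" by blast
      then have "card A = card ({x\<in>A. x < f x} \<union> {x\<in>A. f x < x})" by simp
      also have "\<dots> = card {x\<in>A. x < f x} + card {x\<in>A. f x < x}"
        using that by (intro card_Un_disjoint) auto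
      finally show ?thesis by simp
    qed
    have inj: "inj_on f A" for A by (metis inj_onI periodic_matchingsD(1)[OF f])
    {
      assume block: "\<forall>x\<in>{0..<N}. f x \<in> {0..<N}"
      have "k \<le> 2 * card (?t f \<inter> {0..<int k})" if "k \<le> n + n" for k
      proof -
        have "card {x\<in>{0..<int k}. f x < x} \<le> card {x\<in>{0..<int k}. x < f x}"
        proof (rule card_inj_on_le[OF inj])
          show "f ` {x\<in>{0..<int k}. f x < x} \<subseteq> {x\<in>{0..<int k}. x < f x}"
          proof safe
            fix x assume x: "x \<in> {0..<int k}" "f x < x"
            then have "f x \<in> {0..<N}" using block that by (simp add: N_def)
            then show "f x \<in> {0..<int k}" "f x < f (f x)"
              using x by (auto simp: periodic_matchingsD(1)[OF f])
          qed
        qed (auto intro: finite_subset[of _ "{0..<int k}"])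
        with split[of "{0..<int k}"] have "k \<le> 2 * card {x\<in>{0..<int k}. x < f x}" by simp
        also have "{x\<in>{0..<int k}. x < f x} = ?t f \<inter> {0..<int k}"
          using that by (auto simp: N_def)
        finally show ?thesis .
      qed
      then show "?t f \<in> ballot_sets n n" using card_t by (auto simp: ballot_sets_def N_def)
    }
    assume ballot: "?t f \<in> ballot_sets n n"
    \<comment> \<open>Suppose the arc from \<open>x\<close> leaves the block. All right ends in
      \<open>{x..<N}\<close> have their left ends strictly between \<open>x\<close> and
      \<open>N\<close>, so left ends are in strict majority on \<open>{x..<N}\<close>. With the
      ballot condition on \<open>{0..<x}\<close> this gives more than \<open>n\<close> left ends in
      the block.\<close>
    have up: "f x < N" if x: "x \<in> {0..<N}" for x
    proof (rule ccontr)
      assume fx: "\<not> f x < N"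
      let ?c = "card {y\<in>{x..<N}. f y < y}" and ?o = "card {y\<in>{x..<N}. y < f y}"
      have "?c \<le> card {y\<in>{x<..<N}. y < f y}"
      proof (rule card_inj_on_le[OF inj])
        show "f ` {y\<in>{x..<N}. f y < y} \<subseteq> {y\<in>{x<..<N}. y < f y}"
        proof safe
          fix y assume y: "y \<in> {x..<N}" "f y < y"
          then have "x < y" using fx x by (cases "x = y") auto
          then have "x < f y" using periodic_matchingsD(4)[OF f, of x y] fx y by auto
          then show "f y \<in> {x<..<N}" "f y < f (f y)" using y by (auto simp: periodic_matchingsD(1)[OF f])
        qed
      qed (auto intro: finite_subset[of _ "{x<..<N}"])
      also have "\<dots> < ?o"
      proof -
        have "{y\<in>{x..<N}. y < f y} = insert x {y\<in>{x<..<N}. y < f y}" using x fx by force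
        moreover have "finite {y\<in>{x<..<N}. y < f y}" by (rule finite_subset[of _ "{x<..<N}"]) auto
        ultimately show ?thesis by simp
      qed
      finally have "N - x < 2 * int ?o" using split[of "{x..<N}"] x by simp
      moreover have "nat x \<le> n + n" using x by (simp add: N_def nat_le_iff)
      then have "nat x \<le> 2 * card (?t f \<inter> {0..<int (nat x)})"
        using ballot unfolding ballot_sets_def by blast
      then have "x \<le> 2 * int (card (?t f \<inter> {0..<x}))" using x by simp
      moreover have "n = card (?t f \<inter> {0..<x}) + ?o"
      proof -
        have "{0..<N} = {0..<x} \<union> {x..<N}" using x by auto
        then have "?t f = (?t f \<inter> {0..<x}) \<union> {y\<in>{x..<N}. y < f y}" by blast
        then have "n = card ((?t f \<inter> {0..<x}) \<union> {y\<in>{x..<N}. y < f y})" using card_t by simp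
        also have "\<dots> = card (?t f \<inter> {0..<x}) + ?o"
          by (intro card_Un_disjoint) (auto intro: finite_subset[of _ "{x..<N}"])
        finally show ?thesis .
      qed
      ultimately show False unfolding N_def by linarith
    qed
    show "\<forall>x\<in>{0..<N}. f x \<in> {0..<N}"
    proof
      fix x assume x: "x \<in> {0..<N}"
      \<comment> \<open>An arc reaching below \<open>0\<close> becomes, after translation by
        \<open>N\<close>, an arc that starts in the block and leaves it on the right, which
        \<open>up\<close> excludes.\<close>
      have "0 \<le> f x"
      proof (rule ccontr)
        assume "\<not> 0 \<le> f x"
        moreover have "f x + N > 0" using periodic_matchings_dist[OF f N, of x] x
          unfolding atLeastLessThan_iff by linarith
        ultimately have "f (f x + N) < N" by (intro up) auto
        then show False using x periodic_matchingsD(1,3)[OF f] by simp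
      qed
      then show "f x \<in> {0..<N}" using up[OF x] by simp
    qed
  qed
  have "bij_betw ?t {f \<in> periodic_matchings N. \<forall>x\<in>{0..<N}. f x \<in> {0..<N}} (ballot_sets n n)"
  proof (rule bij_betw_subset[OF periodic_matchings_trace[OF n, folded N_def]])
    have "V \<in> ?t ` periodic_matchings N" if "V \<in> ballot_sets n n" for V
      using that bij_betw_imp_surj_on[OF periodic_matchings_trace[OF n, folded N_def]]
      by (auto simp: ballot_sets_def N_def)
    then show "?t ` {f \<in> periodic_matchings N. \<forall>x\<in>{0..<N}. f x \<in> {0..<N}} = ballot_sets n n"
      using block_iff by blast
  qed auto
  then show ?thesis by (rule bij_betw_same_card)
qed

section \<open>Noncrossing matchings of points on a circle\<close>

text \<open>The points of the circle are represented by the integers modulo \<open>2 d\<close>, and a matching by the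
  relation of being partners, which depends on the residue classes only.\<close>

definition disk_matchings :: "nat \<Rightarrow> (int \<times> int) set set" where
  "disk_matchings d = {M. (\<forall>x y. (x, y) \<in> M \<longrightarrow> (y, x) \<in> M \<and> odd (y - x)) \<and>
     (\<forall>x y. (x + 2 * int d, y) \<in> M \<longleftrightarrow> (x, y) \<in> M) \<and>
     (\<forall>x. \<exists>y. (x, y) \<in> M) \<and>
     (\<forall>x y z. (x, y) \<in> M \<and> (x, z) \<in> M \<longrightarrow> 2 * int d dvd y - z) \<and>
     (\<forall>x y z w. (x, y) \<in> M \<and> (z, w) \<in> M \<longrightarrow> \<not> (x < z \<and> z < y \<and> y < w \<and> w < x + 2 * int d))}"

text \<open>Forgets the lift: different periodic \<open>f\<close> can have the same graph.
  Injectivity therefore holds only on suitably normalised \<open>f\<close>.\<close>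

definition matching_graph :: "int \<Rightarrow> (int \<Rightarrow> int) \<Rightarrow> (int \<times> int) set" where
  "matching_graph N f = {(x, y). N dvd y - f x}"

lemma disk_matchingsD:
  assumes "M \<in> disk_matchings d"
  shows "(x, y) \<in> M \<Longrightarrow> (y, x) \<in> M" "(x, y) \<in> M \<Longrightarrow> odd (y - x)"
    "(x + 2 * int d, y) \<in> M \<longleftrightarrow> (x, y) \<in> M" "\<exists>y. (x, y) \<in> M"
    "(x, y) \<in> M \<Longrightarrow> (x, z) \<in> M \<Longrightarrow> 2 * int d dvd y - z"
    "(x, y) \<in> M \<Longrightarrow> (z, w) \<in> M \<Longrightarrow> x < z \<Longrightarrow> z < y \<Longrightarrow> y < w \<Longrightarrow> w < x + 2 * int d \<Longrightarrow> False"
  using assms unfolding disk_matchings_def by blast+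

lemma periodic_set_dvd:
  fixes N :: int
  assumes per: "\<And>x. P (x + N) \<longleftrightarrow> P x" and dvd: "N dvd y - x"
  shows "P y \<longleftrightarrow> P x"
proof -
  have nat: "P (x + N * int m) \<longleftrightarrow> P x" for m x
  proof (induction m)
    case (Suc m)
    then show ?case using per[of "x + N * int m"] by (simp add: algebra_simps)
  qed simp
  from dvd obtain k where "y - x = N * k" by (rule dvdE)
  then have k: "y = x + N * k" by simp
  show ?thesis
  proof (cases "k \<ge> 0")
    case True
    then show ?thesis using nat[of x "nat k"] k by simp
  next
    case False
    then show ?thesis using nat[of y "nat (- k)"] k by simp
  qed
qed

lemma disk_matchings_cong:
  assumes M: "M \<in> disk_matchings d" and "2 * int d dvd x' - x" "2 * int d dvd y' - y"
  shows "(x', y') \<in> M \<longleftrightarrow> (x, y) \<in> M"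
proof -
  have 1: "(x', y) \<in> M \<longleftrightarrow> (x, y) \<in> M" if "2 * int d dvd x' - x" for x x' y
    by (rule periodic_set_dvd[where P = "\<lambda>x. (x, y) \<in> M" and N = "2 * int d"])
       (use disk_matchingsD(3)[OF M] that in auto)
  from 1[OF assms(2)] 1[OF assms(3)] disk_matchingsD(1)[OF M] show ?thesis by blast
qed

lemma dvd_abs_less_imp_eq:
  fixes x y :: int
  assumes "N dvd x - y" "\<bar>x - y\<bar> < N"
  shows "x = y"
  using zdvd_imp_le[of N "\<bar>x - y\<bar>"] assms by auto

lemma matching_graph_in_disk_matchings:
  assumes d: "d > 0" and f: "f \<in> periodic_matchings (2 * int d)"
  shows "matching_graph (2 * int d) f \<in> disk_matchings d"
proof -
  let ?N = "2 * int d"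
  let ?M = "matching_graph ?N f"
  have N: "?N > 0" using d by simp
  note dist = periodic_matchings_dist[OF f N]
  have graph: "(x, y) \<in> ?M \<longleftrightarrow> (\<exists>k. y = f x + ?N * k)" for x y
    by (auto simp: matching_graph_def dvd_def algebra_simps)
  have sym: "(y, x) \<in> ?M" if "(x, y) \<in> ?M" for x y
  proof -
    from that obtain k where "y = f x + ?N * k" by (auto simp: graph)
    then have "x = f y + ?N * (- k)"
      using periodic_matchings_add_mult[OF f] periodic_matchingsD(1)[OF f] by simp
    then show ?thesis unfolding graph ..
  qed
  moreover have "odd (y - x)" if "(x, y) \<in> ?M" for x y
  proof -
    from that obtain k where "y = f x + ?N * k" by (auto simp: graph)
    then have "y - x = (f x - x) + 2 * (int d * k)" by simp
    then show ?thesis using periodic_matchings_odd[OF f, of x] by simp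
  qed
  moreover have "(x + ?N, y) \<in> ?M \<longleftrightarrow> (x, y) \<in> ?M" for x y
  proof -
    have "y - f x = (y - f (x + ?N)) + ?N" by (simp add: periodic_matchingsD(3)[OF f])
    then show ?thesis by (simp only: matching_graph_def mem_Collect_eq case_prod_conv dvd_add_triv_right_iff)
  qed
  moreover have "\<exists>y. (x, y) \<in> ?M" for x by (rule exI[of _ "f x"]) (simp add: matching_graph_def)
  moreover have "?N dvd y - z" if "(x, y) \<in> ?M" "(x, z) \<in> ?M" for x y z
  proof -
    have "y - z = (y - f x) - (z - f x)" by simp
    then show ?thesis using that by (metis dvd_diff matching_graph_def case_prodD mem_Collect_eq)
  qed
  moreover have False
    if M: "(x, y) \<in> ?M" "(z, w) \<in> ?M" and less: "x < z" "z < y" "y < w" "w < x + ?N" for x y z w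
  proof -
    have "?N dvd y - f x" "?N dvd w - f z" "?N dvd z - f w"
      using M sym by (auto simp: matching_graph_def)
    \<comment> \<open>Since arcs are shorter than \<open>2 * int d\<close>, the lift
      \<open>y\<close> is either \<open>f x\<close> or \<open>f x + 2 * int d\<close>. In the first
      case \<open>z\<close> lies under the arc from \<open>x\<close> to \<open>y\<close>; in the
      second \<open>w\<close> lies under the arc from \<open>y\<close> to
      \<open>x + 2 * int d\<close>. Either way the partner is trapped under that arc.\<close>
    show False
    proof (cases "y = f x")
      case True
      then have "x < f z" "f z < y" using periodic_matchingsD(4,5)[OF f, of x z] less by auto
      then have "w = f z" using \<open>?N dvd w - f z\<close> less by (intro dvd_abs_less_imp_eq) auto
      then show False using \<open>f z < y\<close> less by simp
    next
      case False
      have "?N dvd (y - f x) - ?N" using \<open>?N dvd y - f x\<close> by simp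
      have "y = f x + ?N"
      proof (cases "f x < x")
        case True
        then show ?thesis using dvd_abs_less_imp_eq[of ?N y "f x + ?N"] dist[of x] less \<open>?N dvd (y - f x) - ?N\<close>
          by (simp add: algebra_simps)
      next
        case False
        then have "y = f x"
          using \<open>?N dvd y - f x\<close> dist[of x] less by (intro dvd_abs_less_imp_eq) auto
        with \<open>y \<noteq> f x\<close> show ?thesis by simp
      qed
      then have fy: "f y = x + ?N" using periodic_matchingsD(1,3)[OF f] by simp
      then have "y < f w" "f w < x + ?N" using periodic_matchingsD(4,5)[OF f, of y w] less by auto
      then have "z = f w" using \<open>?N dvd z - f w\<close> less by (intro dvd_abs_less_imp_eq) auto
      then show False using \<open>y < f w\<close> less by simp
    qed
  qed
  ultimately show ?thesis unfolding disk_matchings_def by blast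
qed

text \<open>Common end of both lifting arguments. The assumption \<open>near\<close> keeps the
  endpoints of two interlaced arcs within one turn, so that a crossing on the line would be a
  crossing on the circle.\<close>

lemma matching_graph_of_partner:
  assumes M: "M \<in> disk_matchings d" and f: "\<And>x. (x, f x) \<in> M" "\<And>x. f (f x) = x"
    and per: "\<And>x. f (x + p) = f x + p"
    and near: "\<And>x y. x < y \<Longrightarrow> y < f x \<Longrightarrow> f x < f y + 2 * int d \<and> f y < x + 2 * int d"
  shows "f \<in> periodic_matchings p" "M = matching_graph (2 * int d) f"
proof -
  have "f x \<noteq> x" for x using disk_matchingsD(2)[OF M f(1), of x] by auto
  moreover have "x < f y \<and> f y < f x" if xy: "x < y" "y < f x" for x y
  proof -
    have "f y \<noteq> x" "f y \<noteq> f x" using f(2) xy by (metis less_irrefl)+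
    moreover have "\<not> f x < f y"
      using disk_matchingsD(6)[OF M f(1)[of x] f(1)[of y]] near[OF xy] xy by auto
    moreover have "(f y, y) \<in> M" using f(1)[of "f y"] by (simp add: f(2))
    then have "\<not> f y < x"
      using disk_matchingsD(6)[OF M _ f(1)[of x], of "f y" y] near[OF xy] xy by auto
    ultimately show ?thesis by linarith
  qed
  ultimately show "f \<in> periodic_matchings p" using f per by (auto simp: periodic_matchings_def)
  show "M = matching_graph (2 * int d) f"
  proof -
    have "(x, y) \<in> M \<longleftrightarrow> 2 * int d dvd y - f x" for x y
    proof
      assume "(x, y) \<in> M"
      then show "2 * int d dvd y - f x" using f(1) by (rule disk_matchingsD(5)[OF M])
    next
      assume "2 * int d dvd y - f x"
      then show "(x, y) \<in> M" using disk_matchings_cong[OF M, of x x y "f x"] f(1) by simp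
    qed
    then show ?thesis by (auto simp: matching_graph_def)
  qed
qed

text \<open>The circle is cut just before index \<open>0\<close>: each point gets the lift of its
  partner in its own block of length \<open>2 * int d\<close>, and this lift is unique.\<close>

lemma card_disk_matchings:
  assumes d: "d > 0"
  shows "card (disk_matchings d) = card (ballot_sets d d)"
proof -
  let ?N = "2 * int d"
  let ?B = "{f \<in> periodic_matchings ?N. \<forall>x\<in>{0..<?N}. f x \<in> {0..<?N}}"
  have N: "?N > 0" using d by simp
  have "bij_betw (matching_graph ?N) ?B (disk_matchings d)"
  proof (rule bij_betw_imageI)
    show "inj_on (matching_graph ?N) ?B"
    proof (rule inj_onI)
      fix f g assume f: "f \<in> ?B" and g: "g \<in> ?B" and eq: "matching_graph ?N f = matching_graph ?N g"
      have dvd: "?N dvd f x - g x" for x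
      proof -
        have "(x, f x) \<in> matching_graph ?N f" by (simp add: matching_graph_def)
        then show ?thesis unfolding eq by (simp add: matching_graph_def)
      qed
      show "f = g"
      proof
        fix x
        have r: "x mod ?N \<in> {0..<?N}" using N by simp
        then have "f (x mod ?N) \<in> {0..<?N}" "g (x mod ?N) \<in> {0..<?N}" using f g by blast+
        then have "f (x mod ?N) = g (x mod ?N)"
          using dvd[of "x mod ?N"] by (intro dvd_abs_less_imp_eq) auto
        moreover have "h x = h (x mod ?N) + ?N * (x div ?N)" if "h \<in> periodic_matchings ?N" for h
          using periodic_matchings_add_mult[OF that, of "x mod ?N" "x div ?N"] by simp
        ultimately show "f x = g x" using f g by (metis (lifting) mem_Collect_eq)
      qed
    qed
    have "matching_graph ?N f \<in> disk_matchings d" if "f \<in> ?B" for f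
      using that by (intro matching_graph_in_disk_matchings d) auto
    moreover have "M \<in> matching_graph ?N ` ?B" if M: "M \<in> disk_matchings d" for M
    proof -
      have block: "\<bar>x - y\<bar> < ?N" if "x div ?N = y div ?N" for x y
      proof -
        have "x - y = x mod ?N - y mod ?N"
          using that by (metis add_diff_cancel_left mult_div_mod_eq)
        moreover have "0 \<le> x mod ?N" "x mod ?N < ?N" "0 \<le> y mod ?N" "y mod ?N < ?N" using N by auto
        ultimately show ?thesis by linarith
      qed
      have "\<exists>y. (x, y) \<in> M \<and> y div ?N = x div ?N" for x
      proof -
        obtain z where z: "(x, z) \<in> M" using disk_matchingsD(4)[OF M] by blast
        let ?y = "z mod ?N + ?N * (x div ?N)"
        have "?y - z = ?N * (x div ?N - z div ?N)"
          by (simp add: minus_div_mult_eq_mod[symmetric] algebra_simps)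
        then have "?N dvd ?y - z" by simp
        then have "(x, ?y) \<in> M" using z disk_matchings_cong[OF M, of x x ?y z] by simp
        moreover have "?y div ?N = x div ?N" using N by simp
        ultimately show ?thesis by blast
      qed
      then obtain f where f: "\<And>x. (x, f x) \<in> M" "\<And>x. f x div ?N = x div ?N" by metis
      have f_eq: "f x = y" if "(x, y) \<in> M" "y div ?N = x div ?N" for x y
        using disk_matchingsD(5)[OF M f(1) that(1)] block[of "f x" y] f(2) that(2)
        by (intro dvd_abs_less_imp_eq) auto
      have ff: "f (f x) = x" for x
        by (rule f_eq) (use f disk_matchingsD(1)[OF M] in auto)
      have fN: "f (x + ?N) = f x + ?N" for x
      proof (rule f_eq)
        show "(x + ?N, f x + ?N) \<in> M"
          using disk_matchings_cong[OF M, of "x + ?N" x "f x + ?N" "f x"] f(1) by simp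
        show "(f x + ?N) div ?N = (x + ?N) div ?N" using N f(2)[of x] by simp
      qed
      have near: "f x < f y + ?N \<and> f y < x + ?N" if xy: "x < y" "y < f x" for x y
      proof -
        have "x div ?N \<le> y div ?N" "y div ?N \<le> f x div ?N"
          using xy N by (auto intro: zdiv_mono1)
        then have "y div ?N = x div ?N" using f(2)[of x] by simp
        then show ?thesis using block[of "f x" "f y"] block[of "f y" x] f(2) by auto
      qed
      have "f x \<in> {0..<?N}" if "x \<in> {0..<?N}" for x
      proof -
        have "f x div ?N = 0" using f(2)[of x] that by simp
        then show ?thesis using N by (auto simp: zdiv_eq_0_iff)
      qed
      then show ?thesis using matching_graph_of_partner[OF M f(1) ff fN near] by blast
    qed
    ultimately show "matching_graph ?N ` ?B = disk_matchings d" by blast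
  qed
  then have "card ?B = card (disk_matchings d)" by (rule bij_betw_same_card)
  then show ?thesis using card_block_matchings[OF d] by simp
qed

text \<open>The lift is normalised by length, \<open>\<bar>f x - x\<bar> < int d\<close>. Unlike a
  cut into blocks, this choice commutes with shifts, so invariance of \<open>M\<close> becomes the
  period \<open>2 * int n\<close> of \<open>f\<close>.\<close>

lemma card_shift_invariant_disk_matchings:
  assumes n: "n dvd d" "n < d"
  shows "card {M \<in> disk_matchings d. \<forall>x y. (x + 2 * int n, y + 2 * int n) \<in> M \<longleftrightarrow> (x, y) \<in> M} =
    (2 * n) choose n" (is "card ?F = _")
proof -
  let ?N = "2 * int d" and ?p = "2 * int n"
  have d: "d > 0" using n by simp
  obtain m where m: "d = n * m" using n by (auto elim: dvdE)
  have n0: "n > 0" using d m by (cases n) auto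
  have m2: "m \<ge> 2" using m n by (cases "m = 0"; cases "m = 1") auto
  \<comment> \<open>A proper divisor is at most half of \<open>d\<close>. Hence two lifts with arcs
    shorter than \<open>2 * n\<close> differ by less than \<open>2 * d\<close>, which makes the
    graph map injective.\<close>
  have le: "2 * n \<le> d" using m m2 by simp
  have p: "?p > 0" using n0 by simp
  have pN: "?p dvd ?N" using n by (simp add: m)
  have "bij_betw (matching_graph ?N) (periodic_matchings ?p) ?F"
  proof (rule bij_betw_imageI)
    show "inj_on (matching_graph ?N) (periodic_matchings ?p)"
    proof (rule inj_onI)
      fix f g assume f: "f \<in> periodic_matchings ?p" and g: "g \<in> periodic_matchings ?p"
        and eq: "matching_graph ?N f = matching_graph ?N g"
      show "f = g"
      proof
        fix x
        have "(x, f x) \<in> matching_graph ?N f" by (simp add: matching_graph_def)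
        then have "?N dvd f x - g x" unfolding eq by (simp add: matching_graph_def)
        then show "f x = g x"
          using periodic_matchings_dist[OF f p, of x] periodic_matchings_dist[OF g p, of x] le
          by (intro dvd_abs_less_imp_eq) auto
      qed
    qed
    have "matching_graph ?N f \<in> ?F" if f: "f \<in> periodic_matchings ?p" for f
    proof -
      have "(x + ?p, y + ?p) \<in> matching_graph ?N f \<longleftrightarrow> (x, y) \<in> matching_graph ?N f" for x y
        by (simp add: matching_graph_def periodic_matchingsD(3)[OF f])
      then show ?thesis
        using matching_graph_in_disk_matchings[OF d periodic_matchings_dvd[OF f pN]] by blast
    qed
    moreover have "M \<in> matching_graph ?N ` periodic_matchings ?p" if "M \<in> ?F" for M
    proof -
      from that have M: "M \<in> disk_matchings d"
        and inv: "\<And>x y. (x + ?p, y + ?p) \<in> M \<longleftrightarrow> (x, y) \<in> M" by auto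
      \<comment> \<open>A diameter would cross its image under the rotation, unless the rotation is
        a half turn (\<open>m = 2\<close>) and fixes it. In that case \<open>d\<close> is even, and
        antipodal indices have equal parity, so they are not partners.\<close>
      have no_diam: "(x, x - int d) \<notin> M" for x
      proof
        assume *: "(x, x - int d) \<in> M"
        then have odd: "odd d" using disk_matchingsD(2)[OF M] by fastforce
        then have "m \<noteq> 2" using m by auto
        then have "2 * n < d" using m m2 n0 by simp
        moreover have "(x, x + int d) \<in> M"
          using * disk_matchings_cong[OF M, of x x "x + int d" "x - int d"] by simp
        moreover from this have "(x + ?p, x + int d + ?p) \<in> M" using inv by blast
        ultimately show False using disk_matchingsD(6)[OF M, of x "x + int d" "x + ?p" "x + int d + ?p"] n0
          by auto
      qed
      have "\<exists>y. (x, y) \<in> M \<and> \<bar>y - x\<bar> < int d" for x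
      proof -
        obtain z where z: "(x, z) \<in> M" using disk_matchingsD(4)[OF M] by blast
        let ?r = "(z - x + int d) mod ?N"
        \<comment> \<open>The representative of \<open>z\<close> in the window from
          \<open>x - d\<close> (included) to \<open>x + d\<close> (excluded); \<open>no_diam\<close>
          removes the included end.\<close>
        let ?y = "x - int d + ?r"
        have "?y - z = - ?N * ((z - x + int d) div ?N)"
          by (simp add: minus_div_mult_eq_mod[symmetric])
        then have "?N dvd ?y - z" by simp
        then have y: "(x, ?y) \<in> M" using z disk_matchings_cong[OF M, of x x ?y z] by simp
        moreover have "?r \<noteq> 0" using no_diam[of x] y by auto
        moreover have "0 \<le> ?r" "?r < ?N" using d by auto
        ultimately show ?thesis by (intro exI[of _ ?y]) auto
      qed
      then obtain f where f: "\<And>x. (x, f x) \<in> M" "\<And>x. \<bar>f x - x\<bar> < int d" by metis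
      have f_eq: "f x = y" if "(x, y) \<in> M" "\<bar>y - x\<bar> < int d" for x y
        using disk_matchingsD(5)[OF M f(1) that(1)] f(2)[of x] that(2)
        by (intro dvd_abs_less_imp_eq) auto
      have ff: "f (f x) = x" for x
        by (rule f_eq) (use f disk_matchingsD(1)[OF M] in \<open>auto simp: abs_minus_commute\<close>)
      have fp: "f (x + ?p) = f x + ?p" for x
        by (rule f_eq) (use f inv in auto)
      have near: "f x < f y + ?N \<and> f y < x + ?N" if "x < y" "y < f x" for x y
        using f(2)[of x] f(2)[of y] that by auto
      show ?thesis using matching_graph_of_partner[OF M f(1) ff fp near] by blast
    qed
    ultimately show "matching_graph ?N ` periodic_matchings ?p = ?F" by blast
  qed
  then have "card (periodic_matchings ?p) = card ?F" by (rule bij_betw_same_card)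
  then show ?thesis using card_periodic_matchings[OF n0] by simp
qed

section \<open>Chords of the unit disk\<close>

lemma circle_pt_add: "circle_pt (s + t) = circle_pt s * circle_pt t"
  by (simp add: circle_pt_def cis_mult distrib_left)

lemma circle_pt_of_int [simp]: "circle_pt (of_int k) = 1"
  using cis_multiple_2pi[of "of_int k"] by (simp add: circle_pt_def)

lemma circle_pt_frac [simp]: "circle_pt (frac t) = circle_pt t"
  using circle_pt_add[of "frac t" "of_int \<lfloor>t\<rfloor>"] by (simp add: frac_def)

lemma frac_in_circle [simp]: "frac t \<in> circle"
  by (simp add: circle_def frac_lt_1)

lemma circle_pt_eq_iff: "circle_pt s = circle_pt t \<longleftrightarrow> s - t \<in> \<int>"
proof
  assume "circle_pt s = circle_pt t"
  then have "circle_pt (frac s) = circle_pt (frac t)" by simp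
  then have "frac s = frac t" using inj_onD[OF circle_pt_inj] by simp
  then have "s - t = of_int (\<lfloor>s\<rfloor> - \<lfloor>t\<rfloor>)" by (simp add: frac_def)
  then show "s - t \<in> \<int>" by (metis Ints_of_int)
next
  assume "s - t \<in> \<int>"
  then obtain k where "s - t = of_int k" by (auto elim: Ints_cases)
  then show "circle_pt s = circle_pt t" using circle_pt_add[of t "of_int k"] by (simp add: algebra_simps)
qed

lemma chord_eq_chord_iff:
  "chord s t = chord s' t' \<longleftrightarrow> {circle_pt s, circle_pt t} = {circle_pt s', circle_pt t'}"
  by (simp add: chord_def)

lemma chord_in_chords [simp]: "chord s t \<in> chords"
proof -
  have "chord s t = chord (frac s) (frac t)" by (simp add: chord_def)
  then show ?thesis unfolding chords_def by (auto intro!: frac_in_circle)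
qed

lemma sigma_chord_eq: "sigma_chord d (chord s t) = chord (real d * s) (real d * t)"
proof -
  have *: "circle_pt (sigma d (frac x)) = circle_pt (real d * x)" for x
  proof -
    have "real d * frac x - real d * x = of_int (- int d * \<lfloor>x\<rfloor>)"
      by (simp add: frac_def algebra_simps)
    then have "real d * frac x - real d * x \<in> \<int>" by (metis Ints_of_int)
    then show ?thesis by (simp add: sigma_def circle_pt_eq_iff)
  qed
  have "chord s t = chord (frac s) (frac t)" by (simp add: chord_def)
  then have "sigma_chord d (chord s t) = chord (sigma d (frac s)) (sigma d (frac t))"
    by (simp add: sigma_chord_chord)
  also have "\<dots> = chord (real d * s) (real d * t)" by (simp add: chord_def *)
  finally show ?thesis .
qed

lemma rotate_chord: "(\<lambda>z. cis \<theta> * z) ` chord s t = chord (s + \<theta> / (2 * pi)) (t + \<theta> / (2 * pi))"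
proof -
  have "circle_pt (x + \<theta> / (2 * pi)) = cis \<theta> * circle_pt x" for x
    by (simp add: circle_pt_add) (simp add: circle_pt_def)
  then show ?thesis
    unfolding chord_def by (simp add: closed_segment_linear_image[OF linear_times, symmetric])
qed

text \<open>The chord from \<open>x\<close> to \<open>y\<close> lies on the zero line of this affine functional.\<close>

definition chord_form :: "real \<Rightarrow> real \<Rightarrow> complex \<Rightarrow> real" where
  "chord_form x y z = Re (z * cis (- pi * (x + y))) - cos (pi * (y - x))"

text \<open>The product form shows the sign on the circle: for \<open>x < y < x + 1\<close> it is
  positive on the open arc from \<open>x\<close> to \<open>y\<close> and negative on the open arc
  from \<open>y\<close> to \<open>x + 1\<close>.\<close>

lemma chord_form_circle_pt:
  "chord_form x y (circle_pt t) = 2 * sin (pi * (t - x)) * sin (pi * (y - t))"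
proof -
  have "chord_form x y (circle_pt t) = cos (pi * (2 * t - x - y)) - cos (pi * (y - x))"
    by (simp add: chord_form_def circle_pt_def cis_mult algebra_simps)
  also have "\<dots> = 2 * sin ((pi * (2 * t - x - y) + pi * (y - x)) / 2) * sin ((pi * (y - x) - pi * (2 * t - x - y)) / 2)"
    by (rule cos_diff_cos)
  also have "(pi * (2 * t - x - y) + pi * (y - x)) / 2 = pi * (t - x)" by (simp add: field_simps)
  also have "(pi * (y - x) - pi * (2 * t - x - y)) / 2 = pi * (y - t)" by (simp add: field_simps)
  finally show ?thesis .
qed

lemma chord_form_convex:
  "chord_form x y ((1 - r) *\<^sub>R p + r *\<^sub>R q) = (1 - r) * chord_form x y p + r * chord_form x y q"
  by (simp add: chord_form_def algebra_simps)

lemma sin_pi_pos: "0 < t \<Longrightarrow> t < 1 \<Longrightarrow> 0 < sin (pi * t)"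
  by (intro sin_gt_zero) auto

lemma chord_form_pos: "x < t \<Longrightarrow> t < y \<Longrightarrow> y < x + 1 \<Longrightarrow> 0 < chord_form x y (circle_pt t)"
  unfolding chord_form_circle_pt by (intro mult_pos_pos sin_pi_pos) auto

lemma chord_form_neg:
  assumes "x < y" "y < t" "t < x + 1"
  shows "chord_form x y (circle_pt t) < 0"
proof -
  have "0 < sin (pi * (t - x))" "0 < sin (pi * (t - y))"
    using assms by (auto intro!: sin_pi_pos)
  moreover have "sin (pi * (y - t)) = - sin (pi * (t - y))"
    by (metis minus_diff_eq mult_minus_right sin_minus)
  ultimately show ?thesis unfolding chord_form_circle_pt by (simp add: mult_pos_neg)
qed

lemma chord_form_on_chord: "p \<in> chord x y \<Longrightarrow> chord_form x y p = 0"
  by (auto simp: chord_def in_segment chord_form_convex chord_form_circle_pt)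

lemma chord_disjoint:
  assumes "x < y" "y < x + 1"
    and zw: "x < z \<and> z < y \<and> x < w \<and> w < y \<or> y < z \<and> z < x + 1 \<and> y < w \<and> w < x + 1"
  shows "chord x y \<inter> chord z w = {}"
proof -
  have "chord_form x y p \<noteq> 0" if p: "p \<in> chord z w" for p
  proof -
    from p obtain r where r: "0 \<le> r" "r \<le> 1"
      "chord_form x y p = (1 - r) * chord_form x y (circle_pt z) + r * chord_form x y (circle_pt w)"
      by (auto simp: chord_def in_segment chord_form_convex)
    from zw show ?thesis
    proof
      assume "x < z \<and> z < y \<and> x < w \<and> w < y"
      then have "0 < chord_form x y (circle_pt z)" "0 < chord_form x y (circle_pt w)"
        using assms by (auto intro: chord_form_pos)
      then have "0 < chord_form x y p" unfolding r(3) using r(1,2)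
        by (cases "r = 0") (auto intro!: add_nonneg_pos)
      then show ?thesis by simp
    next
      assume "y < z \<and> z < x + 1 \<and> y < w \<and> w < x + 1"
      then have "chord_form x y (circle_pt z) < 0" "chord_form x y (circle_pt w) < 0"
        using assms by (auto intro: chord_form_neg)
      then have "chord_form x y p < 0" unfolding r(3) using r(1,2)
        by (cases "r = 0") (auto intro!: add_nonpos_neg mult_nonneg_nonpos mult_pos_neg)
      then show ?thesis by simp
    qed
  qed
  then show ?thesis using chord_form_on_chord by blast
qed

text \<open>Multiplication by \<open>cis (- pi * (x + y))\<close> makes the chord vertical, with
  endpoints \<open>Complex c (- s)\<close> and \<open>Complex c s\<close>. A point of the disk with
  real part \<open>c\<close> has imaginary part between \<open>- s\<close> and \<open>s\<close>;
  \<open>r\<close> is its affine parameter.\<close>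

lemma chord_memI:
  assumes xy: "x < y" "y < x + 1" and p: "norm p \<le> 1" "chord_form x y p = 0"
  shows "p \<in> chord x y"
proof -
  define c s where "c = cos (pi * (y - x))" and "s = sin (pi * (y - x))"
  define q where "q = p * cis (- pi * (x + y))"
  have s: "s > 0" unfolding s_def using xy by (intro sin_pi_pos) auto
  have cs: "c\<^sup>2 + s\<^sup>2 = 1" by (simp add: c_def s_def)
  have Re: "Re q = c" using p(2) by (simp add: chord_form_def q_def c_def)
  have "norm q \<le> 1" using p(1) by (simp add: q_def norm_mult)
  then have "(norm q)\<^sup>2 \<le> 1" by (simp add: power_le_one)
  then have "(Im q)\<^sup>2 \<le> s\<^sup>2" using cs Re by (simp add: cmod_power2)
  then have Im: "\<bar>Im q\<bar> \<le> s" using s by (metis abs_le_square_iff abs_of_pos)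
  define r where "r = (Im q / s + 1) / 2"
  have r: "0 \<le> r" "r \<le> 1" using Im s by (auto simp: r_def field_simps abs_le_iff)
  have "2 * pi * x + - pi * (x + y) = - (pi * (y - x))" "2 * pi * y + - pi * (x + y) = pi * (y - x)"
    by (simp_all add: algebra_simps)
  then have E: "circle_pt x * cis (- pi * (x + y)) = Complex c (- s)"
    "circle_pt y * cis (- pi * (x + y)) = Complex c s"
    unfolding circle_pt_def cis_mult c_def s_def by (simp_all add: complex_eq_iff)
  have "q = (1 - r) *\<^sub>R Complex c (- s) + r *\<^sub>R Complex c s"
    using s by (simp add: complex_eq_iff Re r_def field_simps)
  also have "\<dots> = ((1 - r) *\<^sub>R circle_pt x + r *\<^sub>R circle_pt y) * cis (- pi * (x + y))"
    by (simp add: E[symmetric] algebra_simps)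
  finally have "p = (1 - r) *\<^sub>R circle_pt x + r *\<^sub>R circle_pt y"
    by (simp add: q_def)
  then show ?thesis using r by (auto simp: chord_def in_segment)
qed

text \<open>The endpoints of the second chord lie on opposite sides of the first one;
  \<open>r\<close> is the zero of the affine functional between them, and that point lies in the
  disk.\<close>

lemma chord_crossing:
  assumes "x < z" "z < y" "y < w" "w < x + 1"
  shows "chord x y \<inter> chord z w \<noteq> {}"
proof -
  define A B where "A = chord_form x y (circle_pt z)" and "B = chord_form x y (circle_pt w)"
  have AB: "A > 0" "B < 0" unfolding A_def B_def using assms
    by (auto intro!: chord_form_pos chord_form_neg)
  define r where "r = A / (A - B)"
  have r: "0 \<le> r" "r \<le> 1" using AB by (auto simp: r_def field_simps)
  define p where "p = (1 - r) *\<^sub>R circle_pt z + r *\<^sub>R circle_pt w"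
  have "(1 - r) * A + r * B = 0" using AB by (simp add: r_def field_simps)
  then have "chord_form x y p = 0" by (simp add: p_def chord_form_convex A_def B_def)
  moreover have "norm p \<le> 1"
  proof -
    have "norm p \<le> norm ((1 - r) *\<^sub>R circle_pt z) + norm (r *\<^sub>R circle_pt w)"
      unfolding p_def by (rule norm_triangle_ineq)
    also have "\<dots> = 1" using r by (simp add: circle_pt_def)
    finally show ?thesis .
  qed
  ultimately have "p \<in> chord x y" using assms by (intro chord_memI) auto
  moreover have "p \<in> chord z w" using r by (auto simp: p_def chord_def in_segment)
  ultimately show ?thesis by blast
qed

section \<open>Sibling collections as matchings\<close>

lemma disjnt_chords_endpoints:
  "circle_pt s \<in> {circle_pt s', circle_pt t'} \<Longrightarrow> \<not> disjnt (chord s t) (chord s' t')"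
  unfolding disjnt_def chord_def by (metis IntI empty_iff ends_in_segment insertE)

text \<open>The point \<open>pt x\<close> runs through the lifts of the \<open>2 d\<close> preimages of the endpoints in
  increasing order; preimages of \<open>a\<close> have even index, preimages of \<open>b\<close> odd index.\<close>

locale leaf =
  fixes d :: nat and a b :: real
  assumes d_pos: "d > 0" and ab: "0 \<le> a" "a < b" "b < 1"
begin

definition pt :: "int \<Rightarrow> real" where
  "pt x = ((if even x then a else b) + of_int (x div 2)) / real d"

abbreviation "ch x y \<equiv> chord (pt x) (pt y)"
abbreviation "FSC \<equiv> full_sibling_collections d (chord a b)"
abbreviation "N \<equiv> 2 * int d"

definition index_pairs :: "complex set set \<Rightarrow> (int \<times> int) set" where
  "index_pairs C = {(x, y). ch x y \<in> C}"

lemma d_times_pt: "real d * pt x = (if even x then a else b) + of_int (x div 2)"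
  using d_pos by (simp add: pt_def)

lemma pt_shift: "pt (x + 2 * k) = pt x + of_int k / real d"
  by (simp add: pt_def add_divide_distrib)

lemma pt_shift_period: "pt (x + N * k) = pt x + of_int k"
  using pt_shift[of x "int d * k"] d_pos by (simp add: mult.assoc)

text \<open>Consecutive gaps are alternately \<open>(b - a) / d\<close> and
  \<open>(a + 1 - b) / d\<close>, both positive.\<close>

lemma pt_less: "x < y \<Longrightarrow> pt x < pt y"
proof (induction y rule: int_gr_induct)
  have step: "pt x < pt (x + 1)" for x
  proof (cases "even x")
    case True
    then have "(x + 1) div 2 = x div 2" by simp
    then show ?thesis using True ab d_pos by (simp add: pt_def divide_strict_right_mono)
  next
    case False
    then have "(x + 1) div 2 = x div 2 + 1" by (elim oddE) simp
    then show ?thesis using False ab d_pos by (simp add: pt_def divide_strict_right_mono)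
  qed
  case base
  show ?case by (rule step)
  case (step y)
  then show ?case using \<open>\<And>x. pt x < pt (x + 1)\<close>[of y] by simp
qed

lemma pt_less_iff: "pt x < pt y \<longleftrightarrow> x < y"
  by (metis less_asym linorder_cases pt_less)

lemma pt_less_add_one_iff: "pt x < pt y + 1 \<longleftrightarrow> x < y + N"
  using pt_less_iff[of x "y + N"] pt_shift_period[of y 1] by simp

lemma pt_eq_iff: "pt x = pt y \<longleftrightarrow> x = y"
  by (metis less_irrefl linorder_cases pt_less)

lemma circle_pt_pt_eq_iff: "circle_pt (pt x) = circle_pt (pt y) \<longleftrightarrow> N dvd x - y"
proof
  assume "circle_pt (pt x) = circle_pt (pt y)"
  then obtain k where "pt x - pt y = of_int k" by (auto simp: circle_pt_eq_iff elim: Ints_cases)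
  then have "pt x = pt (y + N * k)" by (simp add: pt_shift_period)
  then show "N dvd x - y" by (simp add: pt_eq_iff)
next
  assume "N dvd x - y"
  then obtain k where "x - y = N * k" by (rule dvdE)
  then have "x = y + N * k" by simp
  then have "pt x - pt y = of_int k" using pt_shift_period by simp
  then show "circle_pt (pt x) = circle_pt (pt y)" by (simp add: circle_pt_eq_iff)
qed

lemma ch_eq_iff:
  "ch x y = ch z w \<longleftrightarrow> N dvd x - z \<and> N dvd y - w \<or> N dvd x - w \<and> N dvd y - z"
  by (auto simp: chord_eq_chord_iff doubleton_eq_iff circle_pt_pt_eq_iff)

lemma ch_cong: "N dvd x - z \<Longrightarrow> N dvd y - w \<Longrightarrow> ch x y = ch z w"
  by (simp add: ch_eq_iff)

lemma sigma_ch: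
  "sigma_chord d (ch x y) = chord (if even x then a else b) (if even y then a else b)"
proof -
  have "circle_pt (real d * pt x) = circle_pt (if even x then a else b)" for x
    using d_pos by (simp add: pt_def circle_pt_add)
  then show ?thesis by (simp only: sigma_chord_eq) (simp add: chord_def)
qed

lemma circle_pt_ab: "circle_pt a \<noteq> circle_pt b"
proof
  assume "circle_pt a = circle_pt b"
  then have "a = b" using ab by (intro inj_onD[OF circle_pt_inj]) (auto simp: circle_def)
  then show False using ab by simp
qed

lemma sigma_ch_eq_iff: "sigma_chord d (ch x y) = chord a b \<longleftrightarrow> odd (y - x)"
  using circle_pt_ab by (auto simp: sigma_ch chord_eq_chord_iff doubleton_eq_iff)

lemma sibling_iff:
  "M \<in> chords \<and> sigma_chord d M = chord a b \<longleftrightarrow> (\<exists>x y. odd (y - x) \<and> M = ch x y)"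
proof
  assume M: "M \<in> chords \<and> sigma_chord d M = chord a b"
  then obtain s t where st: "M = chord s t" by (auto simp: chords_def)
  have lift: "\<exists>x. s = pt x \<and> (even x \<longleftrightarrow> c = a)"
    if "circle_pt (real d * s) = circle_pt c" "c = a \<or> c = b" for s c
  proof -
    from that obtain k where "real d * s - c = of_int k"
      by (auto simp: circle_pt_eq_iff elim: Ints_cases)
    then have s: "s = (c + of_int k) / real d" using d_pos by (simp add: field_simps)
    let ?x = "2 * k + (if c = a then 0 else 1)"
    have "s = pt ?x" "even ?x \<longleftrightarrow> c = a" using that(2) by (auto simp: pt_def s)
    then show ?thesis by blast
  qed
  from M st have "{circle_pt (real d * s), circle_pt (real d * t)} = {circle_pt a, circle_pt b}"
    by (simp add: sigma_chord_eq chord_eq_chord_iff)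
  then consider "circle_pt (real d * s) = circle_pt a" "circle_pt (real d * t) = circle_pt b"
    | "circle_pt (real d * s) = circle_pt b" "circle_pt (real d * t) = circle_pt a"
    by (auto simp: doubleton_eq_iff)
  then have "\<exists>x y. s = pt x \<and> t = pt y"
    using lift by cases metis+
  then obtain x y where "M = ch x y" using st by blast
  then show "\<exists>x y. odd (y - x) \<and> M = ch x y" using M sigma_ch_eq_iff by blast
qed (use sigma_ch_eq_iff in auto)

lemma FSC_iff:
  "C \<in> FSC \<longleftrightarrow> (\<forall>M\<in>C. \<exists>x y. odd (y - x) \<and> M = ch x y) \<and> finite C \<and> card C = d \<and> pairwise disjnt C"
  unfolding full_sibling_collections_def sibling_iff[symmetric] by blast

lemma FSC_ch: "C \<in> FSC \<Longrightarrow> M \<in> C \<Longrightarrow> \<exists>x y. odd (y - x) \<and> M = ch x y"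
  by (simp add: FSC_iff)

lemma FSC_eqI:
  assumes "C \<in> FSC" "M \<in> C" "M' \<in> C" "\<not> disjnt M M'"
  shows "M = M'"
  using assms unfolding FSC_iff pairwise_def by blast

lemma ch_crossing: "x < z \<Longrightarrow> z < y \<Longrightarrow> y < w \<Longrightarrow> w < x + N \<Longrightarrow> \<not> disjnt (ch x y) (ch z w)"
  using chord_crossing[of "pt x" "pt z" "pt y" "pt w"]
  by (simp add: disjnt_def pt_less_iff pt_less_add_one_iff)

lemma ch_disjoint:
  assumes "x < y" "y < x + N"
    and "x < z \<and> z < y \<and> x < w \<and> w < y \<or> y < z \<and> z < x + N \<and> y < w \<and> w < x + N"
  shows "disjnt (ch x y) (ch z w)"
  unfolding disjnt_def
  by (rule chord_disjoint) (use assms in \<open>simp_all add: pt_less_iff pt_less_add_one_iff\<close>)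

lemma card_parity_class: "card {x \<in> {0..<N}. even x = e} = d"
proof -
  have "bij_betw (\<lambda>k. 2 * int k + (if e then 0 else 1)) {..<d} {x \<in> {0..<N}. even x = e}"
  proof (rule bij_betw_byWitness[where f' = "\<lambda>x. nat (x div 2)"])
    show "\<forall>x\<in>{x \<in> {0..<N}. even x = e}. 2 * int (nat (x div 2)) + (if e then 0 else 1) = x"
      by auto
  qed auto
  from bij_betw_same_card[OF this] show ?thesis by simp
qed

text \<open>A counting argument: each of the \<open>d\<close> chords has an endpoint of the parity
  of \<open>x\<close>, disjointness makes their residues distinct, and there are only
  \<open>d\<close> residues of that parity, so all of them occur.\<close>

lemma FSC_partner:
  assumes C: "C \<in> FSC"
  shows "\<exists>y. ch x y \<in> C"
proof -
  define e where "e = even x"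
  have "\<exists>p q. M = ch p q \<and> even p = e" if "M \<in> C" for M
  proof -
    obtain p q where "odd (q - p)" "M = ch p q" using FSC_ch[OF C \<open>M \<in> C\<close>] by blast
    then have "M = ch q p" "even p = e \<or> even q = e" by (simp_all add: chord_commute) blast
    with \<open>M = ch p q\<close> show ?thesis by blast
  qed
  then obtain p q where pq: "\<And>M. M \<in> C \<Longrightarrow> M = ch (p M) (q M)" "\<And>M. M \<in> C \<Longrightarrow> even (p M) = e"
    by metis
  define g where "g M = p M mod N" for M
  have "inj_on g C"
  proof (rule inj_onI)
    fix M M' assume M: "M \<in> C" "M' \<in> C" and "g M = g M'"
    then have "N dvd p M - p M'" by (simp add: g_def mod_eq_dvd_iff)
    then have "circle_pt (pt (p M)) = circle_pt (pt (p M'))" by (simp add: circle_pt_pt_eq_iff)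
    then have "\<not> disjnt (ch (p M) (q M)) (ch (p M') (q M'))" by (intro disjnt_chords_endpoints) simp
    then have "\<not> disjnt M M'" using pq(1) M by metis
    then show "M = M'" using FSC_eqI[OF C] M by blast
  qed
  moreover have "g ` C \<subseteq> {x \<in> {0..<N}. even x = e}"
    using d_pos pq(2) by (auto simp: g_def dvd_mod_iff)
  moreover have "card C = d" using C by (simp add: FSC_iff)
  moreover have "finite {x \<in> {0..<N}. even x = e}" by (rule finite_subset[of _ "{0..<N}"]) auto
  ultimately have "g ` C = {x \<in> {0..<N}. even x = e}"
    by (intro card_subset_eq) (simp_all only: card_image card_parity_class)
  moreover have "x mod N \<in> {x \<in> {0..<N}. even x = e}"
    using d_pos by (simp add: e_def dvd_mod_iff)
  ultimately have "x mod N \<in> g ` C" by simp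
  then obtain M where M: "M \<in> C" "x mod N = g M" by (elim imageE)
  then have "p M mod N = x mod N" by (simp add: g_def)
  then have "N dvd p M - x" by (simp add: mod_eq_dvd_iff)
  then have "ch (p M) (q M) = ch x (q M)" by (intro ch_cong) auto
  then show ?thesis using M(1) pq(1) by metis
qed

lemma index_pairs_in_disk_matchings:
  assumes C: "C \<in> FSC"
  shows "index_pairs C \<in> disk_matchings d"
proof -
  have mem: "(x, y) \<in> index_pairs C \<longleftrightarrow> ch x y \<in> C" for x y by (simp add: index_pairs_def)
  have "(y, x) \<in> index_pairs C \<and> odd (y - x)" if "(x, y) \<in> index_pairs C" for x y
    using that C sigma_ch_eq_iff[of x y]
    by (auto simp: mem chord_commute[of "pt y"] full_sibling_collections_def)
  moreover have "(x + N, y) \<in> index_pairs C \<longleftrightarrow> (x, y) \<in> index_pairs C" for x y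
    unfolding mem by (subst ch_cong[of "x + N" x y y]) auto
  moreover have "\<exists>y. (x, y) \<in> index_pairs C" for x
    unfolding mem by (rule FSC_partner[OF C])
  moreover have "N dvd y - z" if "(x, y) \<in> index_pairs C" "(x, z) \<in> index_pairs C" for x y z
  proof -
    have "\<not> disjnt (ch x y) (ch x z)" by (intro disjnt_chords_endpoints) simp
    then have "ch x y = ch x z" using FSC_eqI[OF C] that by (simp add: mem)
    then have "circle_pt (pt y) = circle_pt (pt z)" by (auto simp: chord_eq_chord_iff doubleton_eq_iff)
    then show ?thesis by (simp add: circle_pt_pt_eq_iff)
  qed
  moreover have False if M: "(x, y) \<in> index_pairs C" "(z, w) \<in> index_pairs C"
    and less: "x < z" "z < y" "y < w" "w < x + N" for x y z w
  proof -
    have "ch x y = ch z w" using FSC_eqI[OF C] ch_crossing[OF less] M by (simp add: mem)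
    then have "N dvd x - z \<or> N dvd x - w" by (auto simp: ch_eq_iff)
    then have "x = z \<or> x = w"
      using less dvd_abs_less_imp_eq[of N x z] dvd_abs_less_imp_eq[of N x w] by linarith
    then show False using less by auto
  qed
  ultimately show ?thesis unfolding disk_matchings_def by blast
qed

lemma disk_matching_chords:
  assumes M: "M \<in> disk_matchings d"
  defines "C \<equiv> {ch x y | x y. (x, y) \<in> M}"
  shows "C \<in> FSC" "index_pairs C = M"
proof -
  have mem: "(x, y) \<in> M" if "ch x y \<in> C" for x y
  proof -
    from that obtain z w where zw: "(z, w) \<in> M" "ch x y = ch z w" by (auto simp: C_def)
    then show ?thesis using disk_matchings_cong[OF M] disk_matchingsD(1)[OF M] unfolding ch_eq_iff by blast
  qed
  then show "index_pairs C = M" by (auto simp: index_pairs_def C_def)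
  have disj: "disjnt (ch x y) (ch z w)"
    if xy: "(x, y) \<in> M" and zw: "(z, w) \<in> M" and neq: "ch x y \<noteq> ch z w" for x y z w
  proof -
    \<comment> \<open>All endpoints are moved into the single turn starting at \<open>x\<close>,
      where a chord missing both \<open>x\<close> and \<open>y'\<close> has its ends on one side of
      \<open>y'\<close> or crosses.\<close>
    have norm: "\<exists>y'. N dvd y - y' \<and> x \<le> y' \<and> y' < x + N" for y
    proof (intro exI conjI)
      let ?y = "x + (y - x) mod N"
      have "y - ?y = N * ((y - x) div N)" by (simp add: minus_div_mult_eq_mod[symmetric])
      then show "N dvd y - ?y" by simp
      show "x \<le> ?y" "?y < x + N" using d_pos by auto
    qed
    obtain y' z' w' where y': "N dvd y - y'" "x \<le> y'" "y' < x + N"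
      and z': "N dvd z - z'" "x \<le> z'" "z' < x + N"
      and w': "N dvd w - w'" "x \<le> w'" "w' < x + N"
      using norm by meson
    have eq: "ch x y = ch x y'" "ch z w = ch z' w'"
      by (rule ch_cong; use y' z' w' in simp)+
    have M': "(x, y') \<in> M" "(z', w') \<in> M" "(w', z') \<in> M"
      using xy zw disk_matchings_cong[OF M, of x x y y'] disk_matchings_cong[OF M, of z z' w w']
        y' z' w' disk_matchingsD(1)[OF M] by auto
    have "y' \<noteq> x" using disk_matchingsD(2)[OF M M'(1)] by auto
    have ne: False if "(u, v) \<in> M" "ch u v = ch z w" "u = x \<or> u = y'" for u v
    proof -
      from that(3) have "\<exists>v'. (u, v') \<in> M \<and> ch u v' = ch x y"
        using M' disk_matchingsD(1)[OF M] by (auto simp: eq chord_commute)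
      then obtain v' where "(u, v') \<in> M" "ch u v' = ch x y" by blast
      moreover from this that(1) have "N dvd v - v'" using disk_matchingsD(5)[OF M] by blast
      then have "ch u v = ch u v'" by (intro ch_cong) auto
      ultimately show False using that(2) neq by simp
    qed
    have "z' \<noteq> x" "z' \<noteq> y'" using ne[OF M'(2)] eq by auto
    moreover have "w' \<noteq> x" "w' \<noteq> y'" using ne[OF M'(3)] eq by (auto simp: chord_commute)
    moreover have "\<not> (z' < y' \<and> y' < w')"
      using disk_matchingsD(6)[OF M M'(1,2)] z' w' \<open>z' \<noteq> x\<close> by auto
    moreover have "\<not> (w' < y' \<and> y' < z')"
      using disk_matchingsD(6)[OF M M'(1,3)] z' w' \<open>w' \<noteq> x\<close> by auto
    ultimately show ?thesis unfolding eq using y' z' w' \<open>y' \<noteq> x\<close>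
      by (intro ch_disjoint) auto
  qed
  then have "pairwise disjnt C" unfolding pairwise_def C_def by blast
  moreover have "\<forall>c\<in>C. \<exists>x y. odd (y - x) \<and> c = ch x y"
    using disk_matchingsD(2)[OF M] by (auto simp: C_def)
  moreover obtain p where p: "\<And>x. (x, p x) \<in> M" using disk_matchingsD(4)[OF M] by metis
  \<comment> \<open>Partners have opposite parity, so each chord is counted once by its even
    endpoint.\<close>
  have "bij_betw (\<lambda>x. ch x (p x)) {x \<in> {0..<N}. even x = True} C"
  proof (rule bij_betw_imageI)
    show "inj_on (\<lambda>x. ch x (p x)) {x \<in> {0..<N}. even x = True}"
    proof (rule inj_onI)
      fix x z assume x: "x \<in> {x \<in> {0..<N}. even x = True}" and z: "z \<in> {x \<in> {0..<N}. even x = True}"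
        and "ch x (p x) = ch z (p z)"
      then have "N dvd x - z \<or> N dvd x - p z" by (auto simp: ch_eq_iff)
      then show "x = z"
      proof
        assume "N dvd x - z"
        then show ?thesis using x z by (intro dvd_abs_less_imp_eq) auto
      next
        assume "N dvd x - p z"
        then have "even (x - p z)" by (meson dvd_trans dvd_triv_left)
        moreover have "odd (p z - z)" by (rule disk_matchingsD(2)[OF M p])
        ultimately show ?thesis using x z by auto
      qed
    qed
    have "c \<in> (\<lambda>x. ch x (p x)) ` {x \<in> {0..<N}. even x = True}" if "c \<in> C" for c
    proof -
      from that obtain u v where uv: "(u, v) \<in> M" "c = ch u v" by (auto simp: C_def)
      then have "(v, u) \<in> M" "c = ch v u" "odd (v - u)"
        using disk_matchingsD(1,2)[OF M uv(1)] by (simp_all add: chord_commute)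
      then obtain x y where xy: "(x, y) \<in> M" "c = ch x y" "even x"
        using uv by (cases "even u") auto
      let ?x = "x mod N"
      have dvd: "N dvd ?x - x" by (metis dvd_minus_mod dvd_diff_commute)
      then have "(?x, y) \<in> M" using xy(1) disk_matchings_cong[OF M, of ?x x y y] by simp
      then have "N dvd p ?x - y" using p disk_matchingsD(5)[OF M] by blast
      with dvd have "ch ?x (p ?x) = c" unfolding xy(2) by (rule ch_cong)
      moreover have "?x \<in> {x \<in> {0..<N}. even x = True}" using xy(3) d_pos by (simp add: dvd_mod_iff)
      ultimately show ?thesis by blast
    qed
    then show "(\<lambda>x. ch x (p x)) ` {x \<in> {0..<N}. even x = True} = C"
    proof (intro equalityI subsetI)
      fix c assume "c \<in> (\<lambda>x. ch x (p x)) ` {x \<in> {0..<N}. even x = True}"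
      then obtain x where "c = ch x (p x)" by (elim imageE)
      with p[of x] show "c \<in> C" unfolding C_def mem_Collect_eq by blast
    qed
  qed
  from bij_betw_same_card[OF this] have "card C = d" by (simp only: card_parity_class)
  moreover from this have "finite C" using d_pos by (simp add: card_ge_0_finite)
  ultimately show "C \<in> FSC" unfolding FSC_iff by blast
qed

lemma index_pairs_bij: "bij_betw index_pairs FSC (disk_matchings d)"
proof (rule bij_betw_byWitness[where f' = "\<lambda>M. {ch x y | x y. (x, y) \<in> M}"])
  have "{ch x y | x y. (x, y) \<in> index_pairs C} = C" if "C \<in> FSC" for C
    using FSC_ch[OF that] unfolding index_pairs_def by blast
  then show "\<forall>C\<in>FSC. {ch x y | x y. (x, y) \<in> index_pairs C} = C" by blast
  show "\<forall>M\<in>disk_matchings d. index_pairs {ch x y | x y. (x, y) \<in> M} = M"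
    using disk_matching_chords(2) by blast
  show "index_pairs ` FSC \<subseteq> disk_matchings d" using index_pairs_in_disk_matchings by blast
  show "(\<lambda>M. {ch x y | x y. (x, y) \<in> M}) ` disk_matchings d \<subseteq> FSC"
    using disk_matching_chords(1) by blast
qed

section \<open>Rotations by multiples of \<open>1 / d\<close> of a turn as even index shifts\<close>

lemma rotate_ch: "(\<lambda>z. cis (2 * pi * of_int k / real d) * z) ` ch x y = ch (x + 2 * k) (y + 2 * k)"
  by (simp add: rotate_chord pt_shift)

lemma rotate_collection_FSC:
  assumes C: "C \<in> FSC"
  shows "rotate_collection (2 * pi * of_int k / real d) C \<in> FSC"
proof -
  let ?g = "\<lambda>M. (\<lambda>z. cis (2 * pi * of_int k / real d) * z) ` M"
  have inj: "inj (\<lambda>z. cis (2 * pi * of_int k / real d) * z)" by (rule injI) simp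
  then have "inj_on ?g C" by (meson inj_image_eq_iff inj_onI)
  then have "card (?g ` C) = d" using C by (simp add: card_image FSC_iff)
  moreover have "\<exists>x y. odd (y - x) \<and> ?g M = ch x y" if M: "M \<in> C" for M
  proof -
    obtain x y where "odd (y - x)" "M = ch x y" using FSC_ch[OF C M] by blast
    then have "odd ((y + 2 * k) - (x + 2 * k))" "?g M = ch (x + 2 * k) (y + 2 * k)"
      by (simp_all add: rotate_ch)
    then show ?thesis by blast
  qed
  moreover have "pairwise disjnt (?g ` C)"
  proof -
    have "disjnt (?g M) (?g M')" if "M \<in> C" "M' \<in> C" "?g M \<noteq> ?g M'" for M M'
    proof -
      have "disjnt M M'" using FSC_eqI[OF C that(1,2)] that(3) by blast
      then show ?thesis by (auto simp: disjnt_iff)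
    qed
    then show ?thesis unfolding pairwise_def by blast
  qed
  ultimately show ?thesis using C unfolding FSC_iff rotate_collection_def by blast
qed

lemma index_pairs_rotate:
  assumes "C \<in> FSC"
  shows "(x + 2 * k, y + 2 * k) \<in> index_pairs (rotate_collection (2 * pi * of_int k / real d) C)
    \<longleftrightarrow> (x, y) \<in> index_pairs C"
proof -
  have "inj (\<lambda>z. cis (2 * pi * of_int k / real d) * z)" by (rule injI) simp
  then have "inj (\<lambda>M. (\<lambda>z. cis (2 * pi * of_int k / real d) * z) ` M)"
    by (simp add: inj_def inj_image_eq_iff)
  then show ?thesis
    unfolding index_pairs_def rotate_collection_def mem_Collect_eq case_prod_conv rotate_ch[symmetric]
    by (rule inj_image_mem_iff)
qed

lemma rotation_invariant_iff:
  assumes C: "C \<in> FSC"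
  shows "rotate_collection (2 * pi * of_int k / real d) C = C \<longleftrightarrow>
    (\<forall>x y. (x + 2 * k, y + 2 * k) \<in> index_pairs C \<longleftrightarrow> (x, y) \<in> index_pairs C)"
    (is "?R = C \<longleftrightarrow> ?inv")
proof
  assume "?R = C"
  then show ?inv using index_pairs_rotate[OF C] by metis
next
  assume inv: ?inv
  have "(x, y) \<in> index_pairs ?R \<longleftrightarrow> (x, y) \<in> index_pairs C" for x y
    using index_pairs_rotate[OF C, of "x - 2 * k" k "y - 2 * k"] inv[rule_format, of "x - 2 * k" "y - 2 * k"]
    by simp
  then have "index_pairs ?R = index_pairs C" by auto
  then show "?R = C"
    using bij_betw_imp_inj_on[OF index_pairs_bij] rotate_collection_FSC[OF C] C
    by (auto dest: inj_onD)
qed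

text \<open>Bezout: \<open>M\<close> is invariant under \<open>2 * d\<close> anyway, so invariance
  under \<open>2 * k\<close> passes to every integer combination, in particular to twice the
  gcd.\<close>

lemma shift_invariant_gcd_iff:
  assumes M: "M \<in> disk_matchings d"
  shows "(\<forall>x y. (x + 2 * int k, y + 2 * int k) \<in> M \<longleftrightarrow> (x, y) \<in> M) \<longleftrightarrow>
    (\<forall>x y. (x + 2 * int (gcd k d), y + 2 * int (gcd k d)) \<in> M \<longleftrightarrow> (x, y) \<in> M)"
proof
  let ?Q = "\<lambda>x y t. (x + 2 * t, y + 2 * t) \<in> M"
  assume k: "\<forall>x y. (x + 2 * int k, y + 2 * int k) \<in> M \<longleftrightarrow> (x, y) \<in> M"
  obtain u v where uv: "u * int k + v * int d = gcd (int k) (int d)" using bezout_int by blast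
  have "?Q x y (gcd (int k) (int d)) \<longleftrightarrow> ?Q x y 0" for x y
  proof -
    have "?Q x y (gcd (int k) (int d)) \<longleftrightarrow> ?Q x y (v * int d)"
    proof (rule periodic_set_dvd[where P = "?Q x y" and N = "int k"])
      show "?Q x y (t + int k) \<longleftrightarrow> ?Q x y t" for t
        using k[rule_format, of "x + 2 * t" "y + 2 * t"] by (simp add: algebra_simps)
      have "gcd (int k) (int d) - v * int d = u * int k" using uv by simp
      then show "int k dvd gcd (int k) (int d) - v * int d" by simp
    qed
    also have "\<dots> \<longleftrightarrow> ?Q x y 0" by (rule disk_matchings_cong[OF M]) auto
    finally show ?thesis .
  qed
  then show "\<forall>x y. (x + 2 * int (gcd k d), y + 2 * int (gcd k d)) \<in> M \<longleftrightarrow> (x, y) \<in> M" by simp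
next
  let ?Q = "\<lambda>x y t. (x + 2 * t, y + 2 * t) \<in> M"
  let ?n = "int (gcd k d)"
  assume n: "\<forall>x y. (x + 2 * ?n, y + 2 * ?n) \<in> M \<longleftrightarrow> (x, y) \<in> M"
  have "?Q x y (int k) \<longleftrightarrow> ?Q x y 0" for x y
  proof (rule periodic_set_dvd[where P = "?Q x y" and N = ?n])
    show "?Q x y (t + ?n) \<longleftrightarrow> ?Q x y t" for t
      using n[rule_format, of "x + 2 * t" "y + 2 * t"] by (simp add: algebra_simps)
    show "?n dvd int k - 0" by (simp add: int_dvd_int_iff)
  qed
  then show "\<forall>x y. (x + 2 * int k, y + 2 * int k) \<in> M \<longleftrightarrow> (x, y) \<in> M" by simp
qed

lemma card_FSC: "card FSC = card (ballot_sets d d)"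
  using bij_betw_same_card[OF index_pairs_bij] card_disk_matchings[OF d_pos] by simp

lemma finite_FSC: "finite FSC"
proof -
  \<comment> \<open>Finiteness is read off from the cardinality, since an infinite set has
    \<open>card\<close> equal to \<open>0\<close>.\<close>
  have "real (card (ballot_sets d d)) > 0"
    unfolding card_ballot_sets_diag by (simp add: zero_less_binomial)
  then have "card FSC > 0" using card_FSC by simp
  then show ?thesis by (rule card_ge_0_finite)
qed

lemma card_rotation_invariant:
  "card {C \<in> FSC. rotate_collection (2 * pi * of_int (int k) / real d) C = C} =
    (if gcd k d = d then card (ballot_sets d d) else (2 * gcd k d) choose gcd k d)" (is "card ?F = _")
proof -
  let ?n = "gcd k d"
  define G where
    "G = {M \<in> disk_matchings d. \<forall>x y. (x + 2 * int ?n, y + 2 * int ?n) \<in> M \<longleftrightarrow> (x, y) \<in> M}"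
  have iff: "rotate_collection (2 * pi * of_int (int k) / real d) C = C \<longleftrightarrow> index_pairs C \<in> G"
    if "C \<in> FSC" for C
    using rotation_invariant_iff[OF that, of "int k"] index_pairs_in_disk_matchings[OF that]
      shift_invariant_gcd_iff unfolding G_def by blast
  have "bij_betw index_pairs ?F G"
  proof (rule bij_betw_subset[OF index_pairs_bij])
    have "M \<in> index_pairs ` FSC" if "M \<in> G" for M
      using that bij_betw_imp_surj_on[OF index_pairs_bij] by (simp add: G_def)
    then have "M \<in> index_pairs ` ?F" if "M \<in> G" for M using that iff by fastforce
    moreover have "index_pairs C \<in> G" if "C \<in> ?F" for C using that iff by blast
    ultimately show "index_pairs ` ?F = G" by blast
  qed auto
  then have card: "card ?F = card G" by (rule bij_betw_same_card)
  show ?thesis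
  proof (cases "?n = d")
    case True
    have "(x + N, y + N) \<in> M \<longleftrightarrow> (x, y) \<in> M" if "M \<in> disk_matchings d" for M x y
      by (rule disk_matchings_cong[OF that]) auto
    then have "G = disk_matchings d" unfolding G_def True by blast
    then show ?thesis using card True card_disk_matchings[OF d_pos] by simp
  next
    case False
    then have "?n < d" using d_pos by (simp add: le_neq_implies_less)
    then show ?thesis using card False card_shift_invariant_disk_matchings[of ?n d] by (simp add: G_def)
  qed
qed

text \<open>A rotation that maps preimages of \<open>a\<close> to preimages of \<open>b\<close> has to map preimages of
  \<open>b\<close> to preimages of \<open>a\<close>, which forces the endpoints of the leaf to be antipodal.\<close>

lemma rotation_is_shift:
  assumes C: "C \<in> FSC" and C': "rotate_collection \<theta> C \<in> FSC" and ndiam: "b - a \<noteq> 1 / 2"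
  shows "\<exists>k. rotate_collection \<theta> C = rotate_collection (2 * pi * of_int (int k) / real d) C"
proof -
  define \<tau> where "\<tau> = \<theta> / (2 * pi)"
  have E: "\<exists>y. circle_pt (pt x + \<tau>) = circle_pt (pt y)" for x
  proof -
    obtain y where "ch x y \<in> C" using FSC_partner[OF C] by blast
    then have "chord (pt x + \<tau>) (pt y + \<tau>) \<in> rotate_collection \<theta> C"
      unfolding \<tau>_def rotate_chord[symmetric] rotate_collection_def by (rule imageI)
    then obtain z w where "chord (pt x + \<tau>) (pt y + \<tau>) = ch z w" using FSC_ch[OF C'] by blast
    then show ?thesis by (auto simp: chord_eq_chord_iff doubleton_eq_iff)
  qed
  \<comment> \<open>Indices \<open>0\<close> and \<open>1\<close> give one preimage of
    \<open>a\<close> and one preimage of \<open>b\<close>; following these two is enough.\<close>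
  obtain y where y: "circle_pt (pt 0 + \<tau>) = circle_pt (pt y)" using E by blast
  obtain z where z: "circle_pt (pt 1 + \<tau>) = circle_pt (pt z)" using E by blast
  from y obtain m where m: "pt 0 + \<tau> - pt y = of_int m"
    by (auto simp: circle_pt_eq_iff elim: Ints_cases)
  from z obtain l where l: "pt 1 + \<tau> - pt z = of_int l"
    by (auto simp: circle_pt_eq_iff elim: Ints_cases)
  have \<tau>0: "real d * \<tau> = real d * pt y - real d * pt 0 + real d * of_int m"
    unfolding m[symmetric] by (simp add: algebra_simps)
  have \<tau>1: "real d * \<tau> = real d * pt z - real d * pt 1 + real d * of_int l"
    unfolding l[symmetric] by (simp add: algebra_simps)
  have "even y"
  proof (rule ccontr)
    assume odd: "odd y"
    have "real d * \<tau> = (b - a) + of_int (y div 2 + int d * m)"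
      using \<tau>0 odd by (simp add: d_times_pt)
    moreover have "real d * \<tau> = (if even z then a else b) - b + of_int (z div 2 + int d * l)"
      using \<tau>1 by (simp add: d_times_pt)
    ultimately have eq: "b - a + (b - (if even z then a else b)) = of_int (z div 2 + int d * l - (y div 2 + int d * m))"
      by simp
    show False
    proof (cases "even z")
      case True
      define j where "j = z div 2 + int d * l - (y div 2 + int d * m)"
      have "2 * (b - a) = of_int j" using eq True by (simp add: j_def)
      moreover have "0 < 2 * (b - a)" "2 * (b - a) < 2" using ab by auto
      ultimately have "j = 1" by linarith
      with \<open>2 * (b - a) = of_int j\<close> show False using ndiam by simp
    next
      case False
      define j where "j = z div 2 + int d * l - (y div 2 + int d * m)"
      have "b - a = of_int j" using eq False by (simp add: j_def)
      then have "0 < real_of_int j" "real_of_int j < 1" using ab by auto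
      then show False by simp
    qed
  qed
  define j where "j = y div 2 + int d * m"
  \<comment> \<open>The exponent is reduced modulo \<open>d\<close> to a natural number; the
    quotient accounts for full turns, which do not change \<open>cis \<theta>\<close>.\<close>
  define k where "k = nat (j mod int d)"
  have "real d * \<tau> = of_int j" using \<tau>0 \<open>even y\<close> by (simp add: j_def d_times_pt)
  also have "j = int d * (j div int d) + int k" using d_pos by (simp add: k_def)
  finally have "\<tau> = of_int (j div int d) + real k / real d" using d_pos by (simp add: field_simps)
  then have "\<theta> = 2 * pi * of_int (j div int d) + 2 * pi * of_int (int k) / real d"
    by (simp add: \<tau>_def field_simps)
  then have "cis \<theta> = cis (2 * pi * of_int (j div int d)) * cis (2 * pi * of_int (int k) / real d)"
    by (simp only: cis_mult)
  also have "cis (2 * pi * of_int (j div int d)) = 1" by (rule cis_multiple_2pi) simp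
  finally show ?thesis unfolding rotate_collection_def by (intro exI[of _ k]) simp
qed

lemma card_FSC_quotient:
  assumes ndiam: "b - a \<noteq> 1 / 2"
  shows "d * card (FSC // rotation_rel d (chord a b)) =
    card (ballot_sets d d) + (\<Sum>n | n dvd d \<and> n < d. totient (d div n) * ((2 * n) choose n))"
proof -
  define r where "r = rotate_collection (2 * pi * of_int 1 / real d)"
  have r_pow: "(r ^^ k) C = rotate_collection (2 * pi * of_int (int k) / real d) C" for k C
  proof (induction k)
    case 0
    then show ?case using rotate_collection_0 by simp
  next
    case (Suc k)
    have "2 * pi * of_int 1 / real d + 2 * pi * of_int (int k) / real d = 2 * pi * of_int (int (Suc k)) / real d"
      by (simp add: add_divide_distrib[symmetric] algebra_simps)
    with Suc show ?case by (simp only: r_def funpow.simps o_def rotate_collection_add)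
  qed
  \<comment> \<open>Rotations by arbitrary real angles collapse to powers of the single rotation
    \<open>r\<close>, so the orbit count for a cyclic action applies.\<close>
  have rel: "rotation_rel d (chord a b) = {(C, C'). C \<in> FSC \<and> C' \<in> FSC \<and> (\<exists>k. C' = (r ^^ k) C)}"
    unfolding rotation_rel_def r_pow using rotation_is_shift[OF _ _ ndiam] by blast
  have "d * card (FSC // rotation_rel d (chord a b)) = (\<Sum>k=1..d. card {C \<in> FSC. (r ^^ k) C = C})"
    unfolding rel
  proof (rule card_orbits_cyclic[OF finite_FSC])
    show "r C \<in> FSC" if "C \<in> FSC" for C unfolding r_def using that by (rule rotate_collection_FSC)
    show "(r ^^ d) C = C" if "C \<in> FSC" for C
      using d_pos by (simp add: r_pow rotate_collection_def cis_multiple_2pi[of 1])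
  qed (rule d_pos)
  also have "\<dots> = (\<Sum>k=1..d. if gcd k d = d then card (ballot_sets d d) else (2 * gcd k d) choose gcd k d)"
    unfolding r_pow card_rotation_invariant ..
  also have "\<dots> = (\<Sum>n | n dvd d. totient (d div n) *
      (if n = d then card (ballot_sets d d) else (2 * n) choose n))"
    by (rule sum_gcd_totient[OF d_pos])
  \<comment> \<open>The term \<open>n = d\<close> is the identity rotation, with
    \<open>totient 1 = 1\<close>; it alone carries the ballot count.\<close>
  also have "{n. n dvd d} = insert d {n. n dvd d \<and> n < d}"
    using d_pos by (auto simp: dvd_imp_le le_neq_implies_less)
  also have "(\<Sum>n\<in>\<dots>. totient (d div n) * (if n = d then card (ballot_sets d d) else (2 * n) choose n))
      = card (ballot_sets d d) + (\<Sum>n | n dvd d \<and> n < d. totient (d div n) * ((2 * n) choose n))"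
  proof -
    have "(\<Sum>n | n dvd d \<and> n < d. totient (d div n) * (if n = d then card (ballot_sets d d) else (2 * n) choose n))
        = (\<Sum>n | n dvd d \<and> n < d. totient (d div n) * ((2 * n) choose n))"
      by (rule sum.cong) auto
    then show ?thesis using d_pos by simp
  qed
  finally show ?thesis .
qed

end

lemma chord_antipodal_is_diameter: "is_diameter (chord a (a + 1 / 2))"
proof -
  have "circle_pt (a + 1 / 2) = - circle_pt a"
    by (simp add: circle_pt_add) (simp add: circle_pt_def)
  then have "0 = (1 - 1 / 2) *\<^sub>R circle_pt a + (1 / 2) *\<^sub>R circle_pt (a + 1 / 2)" by simp
  then have "0 \<in> chord a (a + 1 / 2)" unfolding chord_def in_segment by (intro conjI exI[of _ "1/2"]) auto
  then show ?thesis by (simp add: is_diameter_def)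
qed

theorem theorem3p1:
  fixes d :: nat and a b :: real and L :: "complex set"
  assumes "d \<ge> 2"
    and "a \<in> circle" and "b \<in> circle" and "a \<noteq> b"
    and "L = chord a b"
    and "\<not> is_diameter L"
  shows "real (card (full_sibling_collections d L // rotation_rel d L)) =
    1 / real d * (1 / real (d + 1) * real ((2 * d) choose d)
      + (\<Sum>n | n dvd d \<and> n < d. real (totient (d div n)) * real ((2 * n) choose n)))"
proof -
  define a' b' where "a' = min a b" and "b' = max a b"
  have L: "L = chord a' b'" using assms(5) by (auto simp: a'_def b'_def min_def max_def chord_commute)
  interpret leaf d a' b'
    by unfold_locales (use assms(1-4) in \<open>auto simp: a'_def b'_def circle_def\<close>)
  have "b' - a' \<noteq> 1 / 2"
  proof
    assume "b' - a' = 1 / 2"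
    then have "b' = a' + 1 / 2" by simp
    then show False using assms(6) chord_antipodal_is_diameter L by simp
  qed
  from card_FSC_quotient[OF this, folded L]
  have "real d * real (card (full_sibling_collections d L // rotation_rel d L)) =
      1 / real (d + 1) * real ((2 * d) choose d)
      + (\<Sum>n | n dvd d \<and> n < d. real (totient (d div n)) * real ((2 * n) choose n))"
    unfolding card_ballot_sets_diag[symmetric] by (simp flip: of_nat_mult of_nat_add of_nat_sum)
  from this[symmetric] show ?thesis using d_pos by simp
qed

end
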